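(* Let $\mathbf{X}\in\mathbb{R}^{n\times p}$ be a fixed matrix of full column rank with $2\le p<n$, let $\mathbf{y}\in\mathbb{R}^n$ be a fixed vector with $\mathbf{X}^{\mathsf T}\mathbf{y}\ne\mathbf{0}$, let $k>p+1$, and let $\mathbf{S}$ be a $k\times n$ Gaussian sketching matrix. Let $\mathbf{m}\in\mathbb{R}^p$ be a nonzero vector not in the same direction as $\mathbf{X}^{\mathsf T}\mathbf{y}$, i.e. $\mathbf{m}^{\mathsf T}(\mathbf{X}^{\mathsf T}\mathbf{y})\ne\lVert\mathbf{m}\rVert\,\lVert\mathbf{X}^{\mathsf T}\mathbf{y}\rVert$. If $\mathbf{m}^{\mathsf T}\boldsymbol{\beta}_F=0$, then, under the randomness of $\mathbf{S}$ alone, $$\mathbf{m}^{\mathsf T}\boldsymbol{\beta}_p\left\{\frac{k-p+1}{SSM_p\,\gamma\,\mathbf{m}^{\mathsf T}(\mathbf{X}_s^{\mathsf T}\mathbf{X}_s)^{-1}\mathbf{m}-(\mathbf{m}^{\mathsf T}\boldsymbol{\beta}_p)^2}\right\}^{1/2}\sim t_{k-p+1}.$$ In particular, if $\boldsymbol{\beta}_{Fj}=0$ for some $j\in\{1,\dots,p\}$, then $$\boldsymbol{\beta}_{pj}\left[\frac{k-p+1}{SSM_p\,\gamma\,\{(\mathbf{X}_s^{\mathsf T}\mathbf{X}_s)^{-1}\}_{jj}-\boldsymbol{\beta}_{pj}^2}\right]^{1/2}\sim t_{k-p+1}.$$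
   Context: A Gaussian sketching matrix $\mathbf{S}$ of size $k\times n$ has independent entries $\mathbf{S}_{ij}\sim N(0,1/k)$, and $\mathbf{X}_s=\mathbf{S}\mathbf{X}$. The full-data least squares estimate is $\boldsymbol{\beta}_F=(\mathbf{X}^{\mathsf T}\mathbf{X})^{-1}\mathbf{X}^{\mathsf T}\mathbf{y}$. The (unbiased) partial sketch estimator is $\boldsymbol{\beta}_p=\gamma(\mathbf{X}_s^{\mathsf T}\mathbf{X}_s)^{-1}\mathbf{X}^{\mathsf T}\mathbf{y}$ with $\gamma=(k-p-1)/k$, and $SSM_p=\mathbf{y}^{\mathsf T}\mathbf{X}\boldsymbol{\beta}_p=\gamma\,\mathbf{y}^{\mathsf T}\mathbf{X}(\mathbf{X}_s^{\mathsf T}\mathbf{X}_s)^{-1}\mathbf{X}^{\mathsf T}\mathbf{y}$. $\boldsymbol{\beta}_{Fj},\boldsymbol{\beta}_{pj}$ are the $j$-th entries of $\boldsymbol{\beta}_F,\boldsymbol{\beta}_p$; $t_\nu$ is the Student $t$-distribution with $\nu$ degrees of freedom. *)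

theory Defs
  imports "HOL-Probability.Probability"
begin

text \<open>
  Dimensions are types: an $n \times p$ matrix has type \<open>real ^ 'p ^ 'n\<close> (rows outermost), and
  $n$, $p$, $k$ are \<open>CARD('n)\<close>, \<open>CARD('p)\<close>, \<open>CARD('k)\<close>.  The value of \<open>matrix_inv\<close> at singular
  matrices is one fixed unspecified matrix.
\<close>

text \<open>The second argument of \<open>normal_density\<close> is the standard deviation, so variance $1/k$ is
  standard deviation $1/\sqrt{k}$.\<close>

definition gaussian_sketch :: "'w measure \<Rightarrow> ('w \<Rightarrow> real ^ 'n ^ 'k) \<Rightarrow> bool" where
  "gaussian_sketch M S \<longleftrightarrow>
     prob_space.indep_vars M (\<lambda>_. borel) (\<lambda>(i, j) \<omega>. S \<omega> $ i $ j) (UNIV :: ('k \<times> 'n) set) \<and>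
     (\<forall>i j. distributed M lborel (\<lambda>\<omega>. S \<omega> $ i $ j)
              (\<lambda>x. ennreal (normal_density 0 (1 / sqrt (real CARD('k))) x)))"

definition sketched_gram_inv :: "real ^ 'n ^ 'k \<Rightarrow> real ^ 'p ^ 'n \<Rightarrow> real ^ 'p ^ 'p" where
  "sketched_gram_inv S X = matrix_inv (transpose (S ** X) ** (S ** X))"

definition beta_full :: "real ^ 'p ^ 'n \<Rightarrow> real ^ 'n \<Rightarrow> real ^ 'p" where
  "beta_full X y = matrix_inv (transpose X ** X) *v (transpose X *v y)"

definition debias_factor :: "nat \<Rightarrow> nat \<Rightarrow> real" where
  "debias_factor k p = (real k - real p - 1) / real k"

definition beta_partial :: "real ^ 'n ^ 'k \<Rightarrow> real ^ 'p ^ 'n \<Rightarrow> real ^ 'n \<Rightarrow> real ^ 'p" where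
  "beta_partial S X y =
     debias_factor CARD('k) CARD('p) *\<^sub>R (sketched_gram_inv S X *v (transpose X *v y))"

definition SSM_partial :: "real ^ 'n ^ 'k \<Rightarrow> real ^ 'p ^ 'n \<Rightarrow> real ^ 'n \<Rightarrow> real" where
  "SSM_partial S X y = y \<bullet> (X *v beta_partial S X y)"

definition student_t_density :: "real \<Rightarrow> real \<Rightarrow> real" where
  "student_t_density \<nu> x =
     Gamma ((\<nu> + 1) / 2) / (sqrt (\<nu> * pi) * Gamma (\<nu> / 2))
       * (1 + x\<^sup>2 / \<nu>) powr (- (\<nu> + 1) / 2)"

end

theory Submission
  imports Defs
begin

text \<open>
  Write \<open>b = transpose X *v y\<close> and let \<open>A\<close> be the inverse sketched Gram matrix.  The factor \<open>\<gamma>\<close> cancels, and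
  the statistic is \<open>sqrt \<nu> * (m \<bullet> A b) / sqrt ((b \<bullet> A b) * (m \<bullet> A m) - (m \<bullet> A b)\<^sup>2)\<close>.  Let \<open>c\<close> solve
  \<open>(transpose X ** X) *v c = m\<close> and let \<open>a\<close> be the unit vector along \<open>X *v c\<close>; the hypothesis on \<open>beta_full\<close>
  says that \<open>b\<close> and \<open>c\<close> are orthogonal.  The Gaussian vector \<open>z = S *v a\<close> is independent of the remaining part
  of \<open>S\<close>.  Given that part, the sketched design maps the hyperplane orthogonal to \<open>m\<close> onto a fixed subspace
  \<open>V\<close> of dimension \<open>p - 1\<close>, on which \<open>b\<close> is represented by a vector \<open>s\<close> of \<open>V\<close>, and the statistic equals
  \<open>- sqrt \<nu> * (z \<bullet> s / norm s) / norm r\<close>, where \<open>r\<close> is the component of \<open>z\<close> orthogonal to \<open>V\<close>.  This is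
  a centred normal variable divided by the norm of an independent spherical Gaussian vector in dimension
  \<open>k - p + 1\<close>.  The conditional law is therefore Student's, whatever the condition.
\<close>

section \<open>Gaussian measures on Euclidean spaces\<close>

text \<open>Boxes determine a product measure, and the indicator of a box is itself a product, so
  both sides factor on a box. This serves to write the Gaussian law as a product and, later, to tilt
  all coordinates at once.\<close>

lemma density_PiM:
  fixes M :: "'i \<Rightarrow> 'a measure"
  assumes "finite I"
    and M: "\<And>i. sigma_finite_measure (M i)"
    and g [measurable]: "\<And>i. g i \<in> borel_measurable (M i)"
    and D: "\<And>i. sigma_finite_measure (density (M i) (g i))"
  shows "density (PiM I M) (\<lambda>x. \<Prod>i\<in>I. g i (x i)) = PiM I (\<lambda>i. density (M i) (g i))"
proof -
  interpret M: product_sigma_finite M by (simp add: M product_sigma_finite_def)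
  interpret D: product_sigma_finite "\<lambda>i. density (M i) (g i)"
    by (simp add: D product_sigma_finite_def)
  have meas: "(\<lambda>x. \<Prod>i\<in>I. g i (x i)) \<in> borel_measurable (PiM I M)"
    by measurable
  show ?thesis
  proof (rule D.PiM_eqI)
    show "sets (density (PiM I M) (\<lambda>x. \<Prod>i\<in>I. g i (x i))) = sets (PiM I (\<lambda>i. density (M i) (g i)))"
      by (simp cong: sets_PiM_cong)
    fix A assume A: "\<And>i. i \<in> I \<Longrightarrow> A i \<in> sets (density (M i) (g i))"
    then have "PiE I A \<in> sets (PiM I M)"
      using assms(1) by (intro sets_PiM_I_finite) auto
    then have "emeasure (density (PiM I M) (\<lambda>x. \<Prod>i\<in>I. g i (x i))) (PiE I A)
        = (\<integral>\<^sup>+x. (\<Prod>i\<in>I. g i (x i)) * indicator (PiE I A) x \<partial>PiM I M)"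
      using meas by (simp add: emeasure_density)
    also have "\<dots> = (\<integral>\<^sup>+x. (\<Prod>i\<in>I. g i (x i) * indicator (A i) (x i)) \<partial>PiM I M)"
    proof (rule nn_integral_cong)
      fix x assume "x \<in> space (PiM I M)"
      then have "indicator (PiE I A) x = (\<Prod>i\<in>I. indicator (A i) (x i) :: ennreal)"
        using assms(1) by (auto simp: indicator_def space_PiM PiE_iff)
      then show "(\<Prod>i\<in>I. g i (x i)) * indicator (PiE I A) x = (\<Prod>i\<in>I. g i (x i) * indicator (A i) (x i))"
        by (simp add: prod.distrib)
    qed
    also have "\<dots> = (\<Prod>i\<in>I. \<integral>\<^sup>+y. g i y * indicator (A i) y \<partial>M i)"
      using assms(1) A by (intro M.product_nn_integral_prod) auto
    also have "\<dots> = (\<Prod>i\<in>I. emeasure (density (M i) (g i)) (A i))"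
      using A by (intro prod.cong) (auto simp: emeasure_density)
    finally show "emeasure (density (PiM I M) (\<lambda>x. \<Prod>i\<in>I. g i (x i))) (PiE I A)
        = (\<Prod>i\<in>I. emeasure (density (M i) (g i)) (A i))" .
  qed (fact assms(1))
qed

section \<open>Normal laws on the line and on Euclidean spaces\<close>

definition centered_normal :: "real \<Rightarrow> real measure" where
  "centered_normal \<sigma> = density lborel (\<lambda>x. ennreal (normal_density 0 \<sigma> x))"

text \<open>The product over \<open>Basis\<close> builds in independent coordinates. For matrices
  \<open>Basis\<close> consists of the matrix units, so with
  \<open>\<sigma> = 1 / sqrt (real CARD('k))\<close> this is the law of a sketch.\<close>

definition gauss :: "real \<Rightarrow> 'a::euclidean_space measure" where
  "gauss \<sigma> = density lborel (\<lambda>x. \<Prod>b\<in>Basis. ennreal (normal_density 0 \<sigma> (x \<bullet> b)))"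

lemma sets_centered_normal [simp, measurable_cong]: "sets (centered_normal \<sigma>) = sets borel"
  by (simp add: centered_normal_def)

lemma space_centered_normal [simp]: "space (centered_normal \<sigma>) = UNIV"
  by (simp add: centered_normal_def)

lemma sets_gauss [simp, measurable_cong]: "sets (gauss \<sigma>) = sets borel"
  by (simp add: gauss_def)

lemma space_gauss [simp]: "space (gauss \<sigma>) = UNIV"
  by (simp add: gauss_def)

lemma prob_space_centered_normal: "\<sigma> > 0 \<Longrightarrow> prob_space (centered_normal \<sigma>)"
  unfolding centered_normal_def by (rule prob_space_normal_density)

lemma AE_centered_normal_neq_0: "AE y in centered_normal \<sigma>. y \<noteq> 0"
  unfolding centered_normal_def
  by (subst AE_density) (auto intro: AE_mp[OF AE_lborel_singleton[of 0]])

text \<open>\<open>lborel\<close> is itself the image of a product of one-dimensional Lebesgue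
  measures under this reconstruction map, so the density can be pulled back and absorbed coordinate
  by coordinate.\<close>

lemma gauss_eq_distr_PiM:
  assumes "\<sigma> > 0"
  shows "(gauss \<sigma> :: 'a::euclidean_space measure) =
    distr (PiM Basis (\<lambda>_. centered_normal \<sigma>)) borel (\<lambda>f. \<Sum>b\<in>Basis. f b *\<^sub>R b)"
proof -
  let ?L = "PiM (Basis :: 'a set) (\<lambda>_. lborel :: real measure)"
  let ?r = "\<lambda>f. \<Sum>b\<in>(Basis :: 'a set). f b *\<^sub>R b"
  have r [measurable]: "?r \<in> ?L \<rightarrow>\<^sub>M borel"
    by measurable
  have "(gauss \<sigma> :: 'a measure) =
      density (distr ?L borel ?r) (\<lambda>x. \<Prod>b\<in>Basis. ennreal (normal_density 0 \<sigma> (x \<bullet> b)))"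
    unfolding gauss_def by (subst lborel_def) (simp add: lborel_eq_real)
  also have "\<dots> = distr (density ?L (\<lambda>f. \<Prod>b\<in>Basis. ennreal (normal_density 0 \<sigma> (?r f \<bullet> b)))) borel ?r"
    by (rule density_distr) measurable
  also have "density ?L (\<lambda>f. \<Prod>b\<in>Basis. ennreal (normal_density 0 \<sigma> (?r f \<bullet> b))) =
      density ?L (\<lambda>f. \<Prod>b\<in>Basis. ennreal (normal_density 0 \<sigma> (f b)))"
    by (simp cong: prod.cong)
  also have "\<dots> = PiM Basis (\<lambda>_. centered_normal \<sigma>)"
    unfolding centered_normal_def
    using assms prob_space_centered_normal[OF assms]
    by (intro density_PiM)
       (auto simp: centered_normal_def lborel.sigma_finite_measure_axioms
             dest: prob_space_imp_sigma_finite)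
  finally show ?thesis .
qed

lemma prob_space_PiM_centered_normal:
  "\<sigma> > 0 \<Longrightarrow> prob_space (PiM I (\<lambda>_. centered_normal \<sigma>))"
  by (intro prob_space_PiM prob_space_centered_normal)

lemma prob_space_gauss:
  assumes "\<sigma> > 0"
  shows "prob_space (gauss \<sigma>)"
proof -
  interpret prob_space "PiM (Basis :: 'a set) (\<lambda>_. centered_normal \<sigma>)"
    by (rule prob_space_PiM_centered_normal[OF assms])
  show ?thesis
    unfolding gauss_eq_distr_PiM[OF assms] by (intro prob_space_distr) measurable
qed

lemma indep_vars_PiM_coordinates:
  fixes N :: "'a measure"
  assumes "prob_space N" "I \<noteq> {}"
  shows "prob_space.indep_vars (PiM I (\<lambda>_. N)) (\<lambda>_. N) (\<lambda>i f. f i) I"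
proof -
  interpret prob_space "PiM I (\<lambda>_. N)"
    by (intro prob_space_PiM assms)
  have "distr (PiM I (\<lambda>_. N)) (PiM I (\<lambda>_. N)) (\<lambda>f. \<lambda>i\<in>I. f i) = PiM I (\<lambda>_. N)"
    by (rule trans[OF distr_cong distr_id]) (auto simp: space_PiM)
  also have "\<dots> = PiM I (\<lambda>i. distr (PiM I (\<lambda>_. N)) N (\<lambda>f. f i))"
    using distr_PiM_component[of I "\<lambda>_. N"] assms(1) by (intro PiM_cong) auto
  finally show ?thesis
    using assms(2) by (subst indep_vars_iff_distr_eq_PiM') auto
qed

text \<open>\<open>x \<bullet> e\<close> is a sum of independent normals with variances
  \<open>(b \<bullet> e)\<^sup>2 * \<sigma>\<^sup>2\<close>, and these add up to
  \<open>\<sigma>\<^sup>2\<close> because \<open>e\<close> is a unit vector.\<close>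

lemma distr_gauss_inner:
  fixes e :: "'a::euclidean_space"
  assumes "\<sigma> > 0" "norm e = 1"
  shows "distr (gauss \<sigma>) borel (\<lambda>x. x \<bullet> e) = centered_normal \<sigma>"
proof -
  let ?N = "\<lambda>_::'a. centered_normal \<sigma>"
  \<comment> \<open>Zero coefficients are left out: such a summand is constant and has no
    density.\<close>
  let ?J = "{b \<in> Basis. b \<bullet> e \<noteq> 0}"
  interpret prob_space "PiM Basis ?N"
    by (rule prob_space_PiM_centered_normal[OF assms(1)])
  have ind: "indep_vars ?N (\<lambda>b f. f b) Basis"
    by (intro indep_vars_PiM_coordinates prob_space_centered_normal assms) auto
  have "indep_vars (\<lambda>_. borel) (\<lambda>b f. (b \<bullet> e) * f b) Basis"
    by (rule indep_vars_compose2[OF ind, where Y="\<lambda>b x. (b \<bullet> e) * x"]) simp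
  then have "indep_vars (\<lambda>_. borel) (\<lambda>b f. (b \<bullet> e) * f b) ?J"
    by (rule indep_vars_subset) auto
  moreover have "distributed (PiM Basis ?N) lborel (\<lambda>f. f b) (normal_density 0 \<sigma>)" if "b \<in> Basis" for b
    using distr_PiM_component[of Basis ?N b] prob_space_centered_normal[OF assms(1)] that
    by (auto simp: distributed_def centered_normal_def cong: distr_cong)
  then have "distributed (PiM Basis ?N) lborel (\<lambda>f. (b \<bullet> e) * f b) (normal_density 0 (\<bar>b \<bullet> e\<bar> * \<sigma>))"
    if "b \<in> ?J" for b
    using normal_density_affine[of "\<lambda>f. f b" 0 \<sigma> "b \<bullet> e" 0] that assms by auto
  moreover have J: "(\<Sum>b\<in>?J. g b * (b \<bullet> e)) = (\<Sum>b\<in>Basis. g b * (b \<bullet> e))" for g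
    by (intro sum.mono_neutral_left) auto
  have nrm: "(\<Sum>b\<in>Basis. (b \<bullet> e) * (b \<bullet> e)) = 1"
    using assms(2) by (simp add: euclidean_inner[of e e] norm_eq_1 inner_commute)
  have "?J \<noteq> {}"
    using nrm J[of "\<lambda>b. b \<bullet> e"] by (metis sum.empty zero_neq_one)
  ultimately have "distributed (PiM Basis ?N) lborel (\<lambda>f. \<Sum>b\<in>?J. (b \<bullet> e) * f b)
      (normal_density (\<Sum>b\<in>?J. 0) (sqrt (\<Sum>b\<in>?J. (\<bar>b \<bullet> e\<bar> * \<sigma>)\<^sup>2)))"
    using assms(1) by (intro sum_indep_normal) auto
  also have "(\<Sum>b\<in>?J. (\<bar>b \<bullet> e\<bar> * \<sigma>)\<^sup>2) = (\<Sum>b\<in>Basis. (b \<bullet> e) * (b \<bullet> e)) * \<sigma>\<^sup>2"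
    unfolding J[symmetric] sum_distrib_right
    by (intro sum.cong) (auto simp: power_mult_distrib simp flip: power2_eq_square)
  finally have "distributed (PiM Basis ?N) lborel (\<lambda>f. \<Sum>b\<in>?J. f b * (b \<bullet> e)) (normal_density 0 \<sigma>)"
    using assms(1) by (simp add: nrm mult.commute)
  then have "distr (PiM Basis ?N) borel (\<lambda>f. \<Sum>b\<in>Basis. f b * (b \<bullet> e)) = centered_normal \<sigma>"
    unfolding J by (simp add: distributed_def centered_normal_def cong: distr_cong)
  then show ?thesis
    unfolding gauss_eq_distr_PiM[OF assms(1)]
    by (subst distr_distr) (simp_all add: comp_def inner_sum_left)
qed

section \<open>Shears of Lebesgue measure and the Gaussian resampling identity\<close>

lemma borel_measurable_linear:
  fixes f :: "'a::euclidean_space \<Rightarrow> 'b::euclidean_space"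
  shows "linear f \<Longrightarrow> f \<in> borel_measurable borel"
  by (simp add: borel_measurable_continuous_onI linear_continuous_on linear_linear)

lemma nn_integral_lborel_translate:
  fixes c :: "'a::euclidean_space"
  assumes [measurable]: "f \<in> borel_measurable borel"
  shows "(\<integral>\<^sup>+x. f (x + c) \<partial>lborel) = (\<integral>\<^sup>+x. f x \<partial>lborel)"
  by (subst (2) lborel_distr_plus[of c, symmetric], subst nn_integral_distr)
     (simp_all add: add.commute)

text \<open>With the second component fixed the shear is a translation, so Tonelli and translation
  invariance suffice.\<close>

lemma nn_integral_lborel_shear_fst:
  fixes f :: "'a::euclidean_space \<times> 'b::euclidean_space \<Rightarrow> ennreal"
  assumes [measurable]: "f \<in> borel_measurable (borel \<Otimes>\<^sub>M borel)" "A \<in> borel_measurable borel"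
  shows "(\<integral>\<^sup>+z. f (fst z + A (snd z), snd z) \<partial>(lborel \<Otimes>\<^sub>M lborel)) = (\<integral>\<^sup>+z. f z \<partial>(lborel \<Otimes>\<^sub>M lborel))"
proof -
  have "(\<integral>\<^sup>+z. f (fst z + A (snd z), snd z) \<partial>(lborel \<Otimes>\<^sub>M lborel)) =
      (\<integral>\<^sup>+v. \<integral>\<^sup>+u. f (u + A v, v) \<partial>lborel \<partial>lborel)"
    by (subst lborel_pair.nn_integral_snd[symmetric]) auto
  also have "\<dots> = (\<integral>\<^sup>+v. \<integral>\<^sup>+u. f (u, v) \<partial>lborel \<partial>lborel)"
    by (intro nn_integral_cong nn_integral_lborel_translate) measurable
  also have "\<dots> = (\<integral>\<^sup>+z. f z \<partial>(lborel \<Otimes>\<^sub>M lborel))"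
    by (subst lborel_pair.nn_integral_snd[symmetric]) auto
  finally show ?thesis .
qed

lemma nn_integral_lborel_shear_snd:
  fixes f :: "'a::euclidean_space \<times> 'b::euclidean_space \<Rightarrow> ennreal"
  assumes [measurable]: "f \<in> borel_measurable (borel \<Otimes>\<^sub>M borel)" "A \<in> borel_measurable borel"
  shows "(\<integral>\<^sup>+z. f (fst z, snd z + A (fst z)) \<partial>(lborel \<Otimes>\<^sub>M lborel)) = (\<integral>\<^sup>+z. f z \<partial>(lborel \<Otimes>\<^sub>M lborel))"
proof -
  have "(\<integral>\<^sup>+z. f (fst z, snd z + A (fst z)) \<partial>(lborel \<Otimes>\<^sub>M lborel)) =
      (\<integral>\<^sup>+u. \<integral>\<^sup>+v. f (u, v + A u) \<partial>lborel \<partial>lborel)"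
    by (subst lborel.nn_integral_fst[symmetric]) auto
  also have "\<dots> = (\<integral>\<^sup>+u. \<integral>\<^sup>+v. f (u, v) \<partial>lborel \<partial>lborel)"
    by (intro nn_integral_cong nn_integral_lborel_translate) measurable
  also have "\<dots> = (\<integral>\<^sup>+z. f z \<partial>(lborel \<Otimes>\<^sub>M lborel))"
    by (subst lborel.nn_integral_fst[symmetric]) auto
  finally show ?thesis .
qed

text \<open>This form makes the invariance of the density under isometries visible.\<close>

lemma gauss_density_eq_exp_norm:
  fixes x :: "'a::euclidean_space"
  shows "(\<Prod>b\<in>Basis. ennreal (normal_density 0 \<sigma> (x \<bullet> b))) =
    ennreal ((1 / sqrt (2 * pi * \<sigma>\<^sup>2)) ^ DIM('a) * exp (- (norm x)\<^sup>2 / (2 * \<sigma>\<^sup>2)))"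
proof -
  have "(\<Prod>b\<in>Basis. ennreal (normal_density 0 \<sigma> (x \<bullet> b))) = ennreal (\<Prod>b\<in>Basis. normal_density 0 \<sigma> (x \<bullet> b))"
    by (simp add: prod_ennreal)
  also have "(\<Prod>b\<in>Basis. normal_density 0 \<sigma> (x \<bullet> b)) =
      (1 / sqrt (2 * pi * \<sigma>\<^sup>2)) ^ DIM('a) * exp (\<Sum>b\<in>Basis. - (x \<bullet> b)\<^sup>2 / (2 * \<sigma>\<^sup>2))"
    by (simp add: normal_density_def prod.distrib exp_sum prod_dividef power_divide)
  also have "(\<Sum>b\<in>Basis. - (x \<bullet> b)\<^sup>2 / (2 * \<sigma>\<^sup>2)) = - (norm x)\<^sup>2 / (2 * \<sigma>\<^sup>2)"
  proof -
    have "(norm x)\<^sup>2 = (\<Sum>b\<in>Basis. (x \<bullet> b)\<^sup>2)"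
      unfolding power2_norm_eq_inner by (subst euclidean_inner) (simp add: power2_eq_square)
    then show ?thesis
      by (simp add: sum_negf sum_divide_distrib)
  qed
  finally show ?thesis .
qed

text \<open>The pair map \<open>(u, v) \<mapsto> (u - P u - P v, v - P v + P u)\<close> is an isometry and a product of three
  shears, so it preserves \<open>gauss \<sigma> \<Otimes>\<^sub>M gauss \<sigma>\<close>; its second component then has law \<open>gauss \<sigma>\<close>.\<close>

lemma nn_integral_gauss_resample:
  fixes P :: "'a::euclidean_space \<Rightarrow> 'a"
  assumes "\<sigma> > 0" and P: "linear P" "\<And>x. P (P x) = P x" "\<And>x y. P x \<bullet> y = x \<bullet> P y"
    and F [measurable]: "F \<in> borel_measurable borel"
  shows "(\<integral>\<^sup>+x. F x \<partial>gauss \<sigma>) = (\<integral>\<^sup>+v. \<integral>\<^sup>+u. F (v - P v + P u) \<partial>gauss \<sigma> \<partial>gauss \<sigma>)"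
proof -
  define h :: "'a \<Rightarrow> ennreal" where "h x = (\<Prod>b\<in>Basis. ennreal (normal_density 0 \<sigma> (x \<bullet> b)))" for x
  have h [measurable]: "h \<in> borel_measurable borel"
    unfolding h_def by measurable
  have P_meas [measurable]: "P \<in> borel_measurable borel"
    by (rule borel_measurable_linear[OF P(1)])
  have gauss: "gauss \<sigma> = density lborel h"
    by (simp add: gauss_def h_def[abs_def])
  interpret prob_space "gauss \<sigma> :: 'a measure"
    by (rule prob_space_gauss[OF assms(1)])
  have mass: "(\<integral>\<^sup>+x. h x \<partial>lborel) = 1"
    using emeasure_space_1 by (simp add: gauss emeasure_density)
  have PP: "P x \<bullet> P y = P x \<bullet> y" for x y
    by (simp add: P)
  \<comment> \<open>On the range of \<open>P\<close> the pair \<open>(P u, P v)\<close> becomes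
    \<open>(- P v, P u)\<close>, a quarter turn; the components in the kernel of \<open>P\<close>
    stay put. Hence the sum of squared norms is preserved.\<close>
  have rot: "h (u - P u - P v) * h (v - P v + P u) = h u * h v" for u v
  proof -
    have "(norm (u - P u - P v))\<^sup>2 + (norm (v - P v + P u))\<^sup>2 = (norm u)\<^sup>2 + (norm v)\<^sup>2"
      using PP[of u u] PP[of v v] PP[of u v] PP[of v u] P(3)[of u v] P(3)[of v u]
      by (simp add: power2_norm_eq_inner inner_simps inner_commute algebra_simps)
    then have "- (norm (u - P u - P v))\<^sup>2 / (2 * \<sigma>\<^sup>2) + - (norm (v - P v + P u))\<^sup>2 / (2 * \<sigma>\<^sup>2) =
        - (norm u)\<^sup>2 / (2 * \<sigma>\<^sup>2) + - (norm v)\<^sup>2 / (2 * \<sigma>\<^sup>2)"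
      unfolding add_divide_distrib[symmetric] by simp
    then show ?thesis
      unfolding h_def gauss_density_eq_exp_norm
      by (simp add: ennreal_mult[symmetric] exp_add[symmetric] mult_ac
               del: minus_divide_left)
  qed
  \<comment> \<open>\<open>F\<close> reads only the second component, so once the map has been
    undone the first one integrates out to mass 1.\<close>
  define G where "G z = h (fst z) * h (snd z) * F (snd z)" for z
  have G [measurable]: "G \<in> borel_measurable (borel \<Otimes>\<^sub>M borel)"
    unfolding G_def by measurable
  have G_rot: "G (u - P u - P v, v - P v + P u) = h v * (h u * F (v - P v + P u))" for u v
    unfolding G_def fst_conv snd_conv rot by (simp only: mult_ac)
  have "(\<integral>\<^sup>+v. \<integral>\<^sup>+u. F (v - P v + P u) \<partial>gauss \<sigma> \<partial>gauss \<sigma>) =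
      (\<integral>\<^sup>+v. h v * (\<integral>\<^sup>+u. h u * F (v - P v + P u) \<partial>lborel) \<partial>lborel)"
    by (simp add: gauss nn_integral_density)
  also have "\<dots> = (\<integral>\<^sup>+v. \<integral>\<^sup>+u. G (u - P u - P v, v - P v + P u) \<partial>lborel \<partial>lborel)"
    by (simp add: G_rot nn_integral_cmult)
  also have "\<dots> = (\<integral>\<^sup>+z. G (fst z - P (fst z) - P (snd z), snd z - P (snd z) + P (fst z)) \<partial>(lborel \<Otimes>\<^sub>M lborel))"
    by (subst lborel_pair.nn_integral_snd[symmetric]) auto
  also have "\<dots> = (\<integral>\<^sup>+z. G z \<partial>(lborel \<Otimes>\<^sub>M lborel))"
  proof -
    \<comment> \<open>A quarter turn is the product of an upper, a lower and again the same upper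
      unipotent matrix; \<open>?G1\<close> and \<open>?G2\<close> peel these shears off one at a
      time.\<close>
    let ?G1 = "\<lambda>z. G (fst z - P (snd z), snd z)"
    let ?G2 = "\<lambda>z. ?G1 (fst z, snd z + P (fst z))"
    have "(\<integral>\<^sup>+z. G (fst z - P (fst z) - P (snd z), snd z - P (snd z) + P (fst z)) \<partial>(lborel \<Otimes>\<^sub>M lborel)) =
        (\<integral>\<^sup>+z. ?G2 (fst z + (- P (snd z)), snd z) \<partial>(lborel \<Otimes>\<^sub>M lborel))"
      using P by (simp add: linear_add linear_diff linear_neg algebra_simps)
    also have "\<dots> = (\<integral>\<^sup>+z. ?G2 z \<partial>(lborel \<Otimes>\<^sub>M lborel))"
      by (rule nn_integral_lborel_shear_fst[where A="\<lambda>v. - P v"]) measurable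
    also have "\<dots> = (\<integral>\<^sup>+z. ?G1 z \<partial>(lborel \<Otimes>\<^sub>M lborel))"
      by (rule nn_integral_lborel_shear_snd) measurable
    also have "\<dots> = (\<integral>\<^sup>+z. G z \<partial>(lborel \<Otimes>\<^sub>M lborel))"
      using nn_integral_lborel_shear_fst[of G "\<lambda>v. - P v"] by simp
    finally show ?thesis .
  qed
  also have "\<dots> = (\<integral>\<^sup>+v. \<integral>\<^sup>+u. G (u, v) \<partial>lborel \<partial>lborel)"
    by (subst lborel_pair.nn_integral_snd[symmetric]) auto
  also have "\<dots> = (\<integral>\<^sup>+v. h v * F v \<partial>lborel)"
    by (simp add: G_def mult.assoc nn_integral_multc mass)
  also have "\<dots> = (\<integral>\<^sup>+x. F x \<partial>gauss \<sigma>)"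
    by (simp add: gauss nn_integral_density)
  finally show ?thesis ..
qed

text \<open>Induction on the family: resampling along \<open>e j\<close> replaces the coordinate at
  \<open>j\<close> by a fresh normal and leaves the coordinates in \<open>I\<close> untouched, which
  exhibits the joint law as a product.\<close>

lemma nn_integral_gauss_orthonormal:
  fixes e :: "'i \<Rightarrow> 'a::euclidean_space"
  assumes "\<sigma> > 0" "finite I"
    and "\<And>i j. i \<in> I \<Longrightarrow> j \<in> I \<Longrightarrow> e i \<bullet> e j = (if i = j then 1 else 0)"
    and "F \<in> borel_measurable (PiM I (\<lambda>_. borel))"
  shows "(\<integral>\<^sup>+u. F (\<lambda>i\<in>I. u \<bullet> e i) \<partial>gauss \<sigma>) = (\<integral>\<^sup>+x. F x \<partial>PiM I (\<lambda>_. centered_normal \<sigma>))"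
  using assms(2-4)
proof (induction I arbitrary: F rule: finite_induct)
  case empty
  interpret prob_space "gauss \<sigma> :: 'a measure"
    by (rule prob_space_gauss[OF assms(1)])
  show ?case
    by (simp add: PiM_empty restrict_def nn_integral_count_space_finite emeasure_space_1[simplified])
next
  case (insert j I)
  note [measurable] = insert.prems(2)
  let ?N = "\<lambda>_::'i. centered_normal \<sigma>"
  interpret N: product_sigma_finite ?N
    using prob_space_centered_normal[OF assms(1)]
    by (simp add: product_sigma_finite_def prob_space_imp_sigma_finite)
  define P where "P x = (x \<bullet> e j) *\<^sub>R e j" for x
  have j: "e j \<bullet> e j = 1" "\<And>i. i \<in> I \<Longrightarrow> e j \<bullet> e i = 0"
    using insert.prems(1) insert.hyps by (auto split: if_splits)
  then have "norm (e j) = 1"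
    by (simp add: norm_eq_1)
  have P: "linear P" "\<And>x. P (P x) = P x" "\<And>x y. P x \<bullet> y = x \<bullet> P y"
    by (auto simp: P_def j inner_simps inner_commute algebra_simps intro!: linearI)
  \<comment> \<open>By orthonormality the coordinates in \<open>I\<close> come from \<open>v\<close>
    alone and the coordinate at \<open>j\<close> from \<open>w\<close> alone.\<close>
  have upd: "(\<lambda>i\<in>insert j I. (v - P v + P w) \<bullet> e i) = (\<lambda>i\<in>I. v \<bullet> e i)(j := w \<bullet> e j)" for v w
    using insert.hyps j by (auto simp: fun_eq_iff P_def inner_simps)
  have "(\<integral>\<^sup>+u. F (\<lambda>i\<in>insert j I. u \<bullet> e i) \<partial>gauss \<sigma>) =
      (\<integral>\<^sup>+v. \<integral>\<^sup>+w. F ((\<lambda>i\<in>I. v \<bullet> e i)(j := w \<bullet> e j)) \<partial>gauss \<sigma> \<partial>gauss \<sigma>)"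
    by (subst nn_integral_gauss_resample[OF assms(1) P]) (simp_all add: upd)
  also have "\<dots> = (\<integral>\<^sup>+v. \<integral>\<^sup>+y. F ((\<lambda>i\<in>I. v \<bullet> e i)(j := y)) \<partial>centered_normal \<sigma> \<partial>gauss \<sigma>)"
  proof (rule nn_integral_cong)
    fix v :: 'a
    have [measurable]: "(\<lambda>y. F ((\<lambda>i\<in>I. v \<bullet> e i)(j := y))) \<in> borel_measurable borel"
      by measurable
    show "(\<integral>\<^sup>+w. F ((\<lambda>i\<in>I. v \<bullet> e i)(j := w \<bullet> e j)) \<partial>gauss \<sigma>) =
        (\<integral>\<^sup>+y. F ((\<lambda>i\<in>I. v \<bullet> e i)(j := y)) \<partial>centered_normal \<sigma>)"
      by (subst distr_gauss_inner[OF assms(1) \<open>norm (e j) = 1\<close>, symmetric], subst nn_integral_distr) simp_all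
  qed
  also have "\<dots> = (\<integral>\<^sup>+x. \<integral>\<^sup>+y. F (x(j := y)) \<partial>centered_normal \<sigma> \<partial>PiM I ?N)"
  proof (rule insert.IH)
    show "(\<lambda>x. \<integral>\<^sup>+y. F (x(j := y)) \<partial>centered_normal \<sigma>) \<in> borel_measurable (PiM I (\<lambda>_. borel))"
    proof (rule sigma_finite_measure.borel_measurable_nn_integral)
      show "sigma_finite_measure (centered_normal \<sigma>)"
        by (intro prob_space_imp_sigma_finite prob_space_centered_normal assms)
      have "(\<lambda>(x, y). x(j := y)) \<in> PiM I (\<lambda>_. borel) \<Otimes>\<^sub>M borel \<rightarrow>\<^sub>M PiM (insert j I) (\<lambda>_. borel :: real measure)"
        by (rule measurable_add_dim)
      from measurable_compose[OF this insert.prems(2)]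
      show "(\<lambda>(x, y). F (x(j := y))) \<in> borel_measurable (PiM I (\<lambda>_. borel) \<Otimes>\<^sub>M centered_normal \<sigma>)"
        by (simp add: case_prod_beta')
    qed
  qed (use insert.prems(1) in auto)
  also have "\<dots> = (\<integral>\<^sup>+x. F x \<partial>PiM (insert j I) ?N)"
    by (rule N.product_nn_integral_insert[symmetric]) (use insert.hyps in \<open>auto cong: measurable_cong_sets\<close>)
  finally show ?case .
qed

lemma distr_gauss_orthonormal:
  fixes e :: "'i \<Rightarrow> 'a::euclidean_space"
  assumes "\<sigma> > 0" "finite I"
    and "\<And>i j. i \<in> I \<Longrightarrow> j \<in> I \<Longrightarrow> e i \<bullet> e j = (if i = j then 1 else 0)"
  shows "distr (gauss \<sigma>) (PiM I (\<lambda>_. borel)) (\<lambda>u. \<lambda>i\<in>I. u \<bullet> e i) = PiM I (\<lambda>_. centered_normal \<sigma>)"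
proof (rule measure_eqI)
  show "sets (distr (gauss \<sigma>) (PiM I (\<lambda>_. borel)) (\<lambda>u. \<lambda>i\<in>I. u \<bullet> e i)) = sets (PiM I (\<lambda>_. centered_normal \<sigma>))"
    by (simp cong: sets_PiM_cong)
  fix A assume "A \<in> sets (distr (gauss \<sigma>) (PiM I (\<lambda>_. borel)) (\<lambda>u. \<lambda>i\<in>I. u \<bullet> e i))"
  then have A [measurable]: "A \<in> sets (PiM I (\<lambda>_. borel))"
    by simp
  then have A': "A \<in> sets (PiM I (\<lambda>_. centered_normal \<sigma>))"
    by (simp cong: sets_PiM_cong)
  have "emeasure (distr (gauss \<sigma>) (PiM I (\<lambda>_. borel)) (\<lambda>u. \<lambda>i\<in>I. u \<bullet> e i)) A =
      (\<integral>\<^sup>+x. indicator A x \<partial>distr (gauss \<sigma>) (PiM I (\<lambda>_. borel)) (\<lambda>u. \<lambda>i\<in>I. u \<bullet> e i))"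
    by simp
  also have "\<dots> = (\<integral>\<^sup>+u. indicator A (\<lambda>i\<in>I. u \<bullet> e i) \<partial>gauss \<sigma>)"
    by (rule nn_integral_distr) measurable
  also have "\<dots> = (\<integral>\<^sup>+x. indicator A x \<partial>PiM I (\<lambda>_. centered_normal \<sigma>))"
    by (rule nn_integral_gauss_orthonormal[OF assms]) measurable
  also have "\<dots> = emeasure (PiM I (\<lambda>_. centered_normal \<sigma>)) A"
    using A' by simp
  finally show "emeasure (distr (gauss \<sigma>) (PiM I (\<lambda>_. borel)) (\<lambda>u. \<lambda>i\<in>I. u \<bullet> e i)) A =
    emeasure (PiM I (\<lambda>_. centered_normal \<sigma>)) A" .
qed

section \<open>Student's distribution as a normal scale mixture\<close>

lemma nn_integral_exp_neg_square:
  fixes a :: real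
  assumes "a > 0"
  shows "(\<integral>\<^sup>+t. ennreal (exp (- a * t\<^sup>2)) \<partial>lborel) = ennreal (sqrt (pi / a))"
proof -
  define \<tau> where "\<tau> = sqrt (1 / (2 * a))"
  have \<tau>: "\<tau> > 0" "\<tau>\<^sup>2 = 1 / (2 * a)"
    using assms by (simp_all add: \<tau>_def)
  have "exp (- a * t\<^sup>2) = sqrt (pi / a) * normal_density 0 \<tau> t" for t
    using assms by (simp add: normal_density_def \<tau>(2) field_simps)
  then have "(\<integral>\<^sup>+t. ennreal (exp (- a * t\<^sup>2)) \<partial>lborel) =
      ennreal (sqrt (pi / a)) * (\<integral>\<^sup>+t. ennreal (normal_density 0 \<tau> t) \<partial>lborel)"
    using assms by (simp add: ennreal_mult nn_integral_cmult)
  also have "(\<integral>\<^sup>+t. ennreal (normal_density 0 \<tau> t) \<partial>lborel) = 1"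
    using \<tau> by (subst nn_integral_eq_integral) simp_all
  finally show ?thesis by simp
qed

text \<open>The substitution of \<open>w * u\<close> for the variable in the Gamma integral. It
  trades a power of \<open>w\<close> for an average of exponentials.\<close>

lemma Gamma_mult_powr_conv_nn_integral:
  fixes s w :: real
  assumes "s > 0" "w > 0"
  shows "ennreal (Gamma s * w powr (- s)) =
    (\<integral>\<^sup>+u. ennreal (indicator {0..} u * u powr (s - 1) * exp (- w * u)) \<partial>lborel)"
proof -
  have "ennreal (Gamma s) = (\<integral>\<^sup>+u. ennreal (indicator {0..} u * u powr (s - 1) / exp u) \<partial>lborel)"
    by (rule Gamma_conv_nn_integral_real[OF assms(1)])
  also have "\<dots> = ennreal \<bar>w\<bar> * (\<integral>\<^sup>+u. ennreal (indicator {0..} (0 + w * u) * (0 + w * u) powr (s - 1) / exp (0 + w * u)) \<partial>lborel)"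
    by (rule nn_integral_real_affine) (use assms in auto)
  also have "\<dots> = (\<integral>\<^sup>+u. ennreal (w powr s) * ennreal (indicator {0..} u * u powr (s - 1) * exp (- w * u)) \<partial>lborel)"
  proof (subst nn_integral_cmult[symmetric], simp, rule nn_integral_cong)
    fix u :: real
    have "\<bar>w\<bar> * (indicator {0..} (0 + w * u) * (0 + w * u) powr (s - 1) / exp (0 + w * u)) =
        w powr s * (indicator {0..} u * u powr (s - 1) * exp (- w * u))"
      using assms
      by (auto simp: indicator_def powr_mult powr_diff exp_minus field_simps zero_le_mult_iff)
    then show "ennreal \<bar>w\<bar> * ennreal (indicator {0..} (0 + w * u) * (0 + w * u) powr (s - 1) / exp (0 + w * u)) =
        ennreal (w powr s) * ennreal (indicator {0..} u * u powr (s - 1) * exp (- w * u))"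
      by (simp add: ennreal_mult'[symmetric] del: add_0)
  qed
  also have "\<dots> = ennreal (w powr s) * (\<integral>\<^sup>+u. ennreal (indicator {0..} u * u powr (s - 1) * exp (- w * u)) \<partial>lborel)"
    by (rule nn_integral_cmult) measurable
  finally have Gamma: "ennreal (Gamma s) = ennreal (w powr s) *
      (\<integral>\<^sup>+u. ennreal (indicator {0..} u * u powr (s - 1) * exp (- w * u)) \<partial>lborel)" (is "_ = _ * ?J") .
  have "ennreal (Gamma s * w powr (- s)) = ennreal (w powr (- s)) * ennreal (Gamma s)"
    using assms by (simp add: ennreal_mult' mult.commute)
  also have "\<dots> = ennreal (w powr (- s)) * ennreal (w powr s) * ?J"
    unfolding Gamma by (simp only: mult.assoc)
  also have "ennreal (w powr (- s)) * ennreal (w powr s) = 1"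
    using assms by (simp add: ennreal_mult'[symmetric] powr_add[symmetric])
  finally show ?thesis by simp
qed

text \<open>The kernel is a Gamma average of Gaussians in \<open>t\<close>. After Fubini the inner
  Gaussian integral contributes \<open>sqrt (\<nu> * pi / u)\<close>, which lowers the exponent of
  \<open>u\<close> from \<open>s - 1\<close> to \<open>\<nu> / 2 - 1\<close>, and the outer integral
  becomes \<open>Gamma (\<nu> / 2)\<close>.\<close>

lemma nn_integral_student_kernel:
  fixes \<nu> :: real
  assumes "\<nu> > 0"
  shows "(\<integral>\<^sup>+t. ennreal ((1 + t\<^sup>2 / \<nu>) powr (- (\<nu> + 1) / 2)) \<partial>lborel) =
    ennreal (sqrt (\<nu> * pi) * Gamma (\<nu> / 2) / Gamma ((\<nu> + 1) / 2))"
proof -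
  define s where "s = (\<nu> + 1) / 2"
  have s: "s > 0" "Gamma s > 0"
    using assms by (simp_all add: s_def Gamma_real_pos)
  have w: "1 + t\<^sup>2 / \<nu> > 0" for t
    using assms by (simp add: add_pos_nonneg)
  let ?g = "\<lambda>u::real. indicator {0..} u * u powr (s - 1) :: real"
  have "ennreal (Gamma s) * (\<integral>\<^sup>+t. ennreal ((1 + t\<^sup>2 / \<nu>) powr (- (\<nu> + 1) / 2)) \<partial>lborel) =
      (\<integral>\<^sup>+t. ennreal (Gamma s * (1 + t\<^sup>2 / \<nu>) powr (- s)) \<partial>lborel)"
    using s by (subst nn_integral_cmult[symmetric]) (simp_all add: ennreal_mult s_def add.commute minus_divide_left)
  also have "\<dots> = (\<integral>\<^sup>+t. \<integral>\<^sup>+u. ennreal (?g u * exp (- (1 + t\<^sup>2 / \<nu>) * u)) \<partial>lborel \<partial>lborel)"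
    using s w by (intro nn_integral_cong Gamma_mult_powr_conv_nn_integral)
  also have "\<dots> = (\<integral>\<^sup>+u. \<integral>\<^sup>+t. ennreal (?g u * exp (- (1 + t\<^sup>2 / \<nu>) * u)) \<partial>lborel \<partial>lborel)"
    by (rule lborel_pair.Fubini'[symmetric]) measurable
  also have "\<dots> = (\<integral>\<^sup>+u. ennreal (sqrt (\<nu> * pi)) * ennreal (indicator {0..} u * u powr (\<nu> / 2 - 1) / exp u) \<partial>lborel)"
  proof (rule nn_integral_cong)
    fix u :: real
    show "(\<integral>\<^sup>+t. ennreal (?g u * exp (- (1 + t\<^sup>2 / \<nu>) * u)) \<partial>lborel) =
        ennreal (sqrt (\<nu> * pi)) * ennreal (indicator {0..} u * u powr (\<nu> / 2 - 1) / exp u)"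
    proof (cases "u > 0")
      case True
      have "(\<integral>\<^sup>+t. ennreal (?g u * exp (- (1 + t\<^sup>2 / \<nu>) * u)) \<partial>lborel) =
          (\<integral>\<^sup>+t. ennreal (?g u * exp (- u)) * ennreal (exp (- (u / \<nu>) * t\<^sup>2)) \<partial>lborel)"
        by (intro nn_integral_cong)
           (simp add: ennreal_mult'[symmetric] exp_add[symmetric] algebra_simps)
      also have "\<dots> = ennreal (?g u * exp (- u)) * ennreal (sqrt (pi / (u / \<nu>)))"
        using True assms by (subst nn_integral_cmult, simp, subst nn_integral_exp_neg_square) simp_all
      also have "\<dots> = ennreal (sqrt (\<nu> * pi)) * ennreal (indicator {0..} u * u powr (\<nu> / 2 - 1) / exp u)"
      proof -
        have "u powr (s - 1) = u powr (\<nu> / 2 - 1) * sqrt u"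
          using True by (simp add: s_def powr_half_sqrt[symmetric] powr_add[symmetric] field_simps)
        then have "?g u * exp (- u) * sqrt (pi / (u / \<nu>)) =
            sqrt (\<nu> * pi) * (indicator {0..} u * u powr (\<nu> / 2 - 1) / exp u)"
          using True assms by (simp add: exp_minus real_sqrt_mult real_sqrt_divide field_simps)
        then show ?thesis
          using assms True by (simp add: ennreal_mult'[symmetric])
      qed
      finally show ?thesis .
    \<comment> \<open>For \<open>u \<le> 0\<close> both sides vanish: by the indicator if
      \<open>u < 0\<close>, and by \<open>0 powr _ = 0\<close> if \<open>u = 0\<close>.\<close>
    qed (auto simp: indicator_def)
  qed
  also have "\<dots> = ennreal (sqrt (\<nu> * pi)) * ennreal (Gamma (\<nu> / 2))"
    using assms by (subst nn_integral_cmult) (simp_all add: Gamma_conv_nn_integral_real)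
  finally have eq: "ennreal (Gamma s) * (\<integral>\<^sup>+t. ennreal ((1 + t\<^sup>2 / \<nu>) powr (- (\<nu> + 1) / 2)) \<partial>lborel) =
      ennreal (sqrt (\<nu> * pi) * Gamma (\<nu> / 2))" (is "_ * ?J = _")
    using assms by (simp add: ennreal_mult'[symmetric])
  have "ennreal (1 / Gamma s) * ennreal (Gamma s) = ennreal (1 / Gamma s * Gamma s)"
    using s(2) by (intro ennreal_mult'[symmetric]) simp
  also have "1 / Gamma s * Gamma s = 1"
    using s(2) by (metis less_irrefl nonzero_eq_divide_eq)
  finally have "?J = ennreal (1 / Gamma s) * (ennreal (Gamma s) * ?J)"
    by (simp add: mult.assoc[symmetric])
  also have "\<dots> = ennreal (sqrt (\<nu> * pi) * Gamma (\<nu> / 2) / Gamma s)"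
    unfolding eq using s assms by (simp add: ennreal_mult'[symmetric])
  finally show ?thesis by (simp add: s_def)
qed

section \<open>Scaling, tilting and mixing of normal laws\<close>

lemma distr_centered_normal_mult:
  assumes "\<sigma> > 0" "c > 0"
  shows "distr (centered_normal \<sigma>) borel (\<lambda>y. y * c) = centered_normal (\<sigma> * c)"
proof -
  interpret prob_space "centered_normal \<sigma>"
    by (rule prob_space_centered_normal[OF assms(1)])
  have "distributed (centered_normal \<sigma>) lborel (\<lambda>y. y) (normal_density 0 \<sigma>)"
    by (simp add: distributed_def centered_normal_def distr_id2)
  from normal_density_affine[OF this assms(1), of c 0] assms
  have "distributed (centered_normal \<sigma>) lborel (\<lambda>y. y * c) (normal_density 0 (\<sigma> * c))"
    by (simp add: mult.commute)
  then show ?thesis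
    by (simp add: distributed_def centered_normal_def cong: distr_cong)
qed

text \<open>The two exponents add to that of a normal law whose variance is divided by
  \<open>1 + t\<^sup>2 / \<nu>\<close>; the square root is the matching normalisation.\<close>

lemma centered_normal_tilt:
  assumes "\<sigma> > 0" "\<nu> > 0"
  shows "density (centered_normal \<sigma>)
      (\<lambda>y. ennreal (sqrt (1 + t\<^sup>2 / \<nu>) * exp (- t\<^sup>2 * y\<^sup>2 / (2 * \<nu> * \<sigma>\<^sup>2)))) =
    centered_normal (\<sigma> * (1 / sqrt (1 + t\<^sup>2 / \<nu>)))"
proof -
  define l where "l = sqrt (1 + t\<^sup>2 / \<nu>)"
  have "1 + t\<^sup>2 / \<nu> > 0"
    using assms by (simp add: add_pos_nonneg)
  then have l: "l > 0" "l\<^sup>2 = 1 + t\<^sup>2 / \<nu>"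
    by (simp_all add: l_def)
  have eq: "normal_density 0 \<sigma> y * (l * exp (- t\<^sup>2 * y\<^sup>2 / (2 * \<nu> * \<sigma>\<^sup>2))) = normal_density 0 (\<sigma> * (1 / l)) y" for y
  proof -
    have "- y\<^sup>2 / (2 * \<sigma>\<^sup>2) + - t\<^sup>2 * y\<^sup>2 / (2 * \<nu> * \<sigma>\<^sup>2) = - y\<^sup>2 / (2 * \<sigma>\<^sup>2) * l\<^sup>2"
      unfolding l(2) using assms by (simp add: field_simps)
    also have "\<dots> = - y\<^sup>2 / (2 * (\<sigma> * (1 / l))\<^sup>2)"
      using l(1) assms by (simp add: field_simps)
    finally have "exp (- y\<^sup>2 / (2 * \<sigma>\<^sup>2)) * exp (- t\<^sup>2 * y\<^sup>2 / (2 * \<nu> * \<sigma>\<^sup>2)) =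
        exp (- y\<^sup>2 / (2 * (\<sigma> * (1 / l))\<^sup>2))"
      by (simp only: exp_add[symmetric])
    moreover have "1 / sqrt (2 * pi * \<sigma>\<^sup>2) * l = 1 / sqrt (2 * pi * (\<sigma> * (1 / l))\<^sup>2)"
      using l(1) assms by (simp add: real_sqrt_mult real_sqrt_divide power_divide field_simps)
    ultimately show ?thesis
      unfolding normal_density_def by (simp add: mult_ac del: times_divide_eq_right times_divide_eq_left)
  qed
  show ?thesis
    unfolding centered_normal_def l_def[symmetric]
    by (subst density_density_eq)
       (measurable, simp only: ennreal_mult'[symmetric, OF normal_density_nonneg] eq)
qed

text \<open>Exponential tilting turns \<open>N(0, \<sigma>\<^sup>2)\<close> coordinates into \<open>N(0, \<sigma>\<^sup>2 / l\<^sup>2)\<close> ones with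
  \<open>l\<^sup>2 = 1 + t\<^sup>2 / \<nu>\<close>, so scaling gives the \<open>t\<close>-dependence of the mixture and the chi-square density
  is never needed.\<close>

lemma nn_integral_normal_scale_mixture:
  fixes \<sigma> \<nu> :: real
  assumes "\<sigma> > 0" "\<nu> = real (card I)" "finite I" "I \<noteq> {}"
  shows "(\<integral>\<^sup>+x. ennreal (normal_density 0 (\<sigma> * sqrt (\<nu> / (\<Sum>i\<in>I. (x i)\<^sup>2))) t) \<partial>PiM I (\<lambda>_. centered_normal \<sigma>)) =
    (\<integral>\<^sup>+x. ennreal (sqrt (\<Sum>i\<in>I. (x i)\<^sup>2) / (\<sigma> * sqrt (2 * pi * \<nu>))) \<partial>PiM I (\<lambda>_. centered_normal \<sigma>)) *
    ennreal ((1 + t\<^sup>2 / \<nu>) powr (- (\<nu> + 1) / 2))"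
proof -
  let ?P = "\<lambda>\<sigma>. PiM I (\<lambda>_. centered_normal \<sigma>)"
  define q :: "('a \<Rightarrow> real) \<Rightarrow> real" where "q x = (\<Sum>i\<in>I. (x i)\<^sup>2)" for x
  define g where "g y = exp (- t\<^sup>2 * y\<^sup>2 / (2 * \<nu> * \<sigma>\<^sup>2))" for y
  define K where "K = \<sigma> * sqrt (2 * pi * \<nu>)"
  define l where "l = sqrt (1 + t\<^sup>2 / \<nu>)"
  have q [measurable]: "q \<in> borel_measurable (?P \<tau>)" for \<tau>
    unfolding q_def by measurable
  have g_meas [measurable]: "g \<in> borel_measurable borel"
    unfolding g_def by measurable
  have q0: "q x \<ge> 0" for x
    by (simp add: q_def sum_nonneg)
  have \<nu>: "\<nu> > 0"
    using assms by (simp add: card_gt_0_iff)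
  then have K: "K > 0"
    using assms by (simp add: K_def)
  have l2: "1 + t\<^sup>2 / \<nu> > 0"
    using \<nu> by (simp add: add_pos_nonneg)
  then have l: "l > 0"
    by (simp add: l_def)
  have sig: "sigma_finite_measure (centered_normal \<tau>)" if "\<tau> > 0" for \<tau>
    using that by (intro prob_space_imp_sigma_finite prob_space_centered_normal)
  have "normal_density 0 (\<sigma> * sqrt (\<nu> / q x)) t = sqrt (q x) / K * (\<Prod>i\<in>I. g (x i))" for x
  proof -
    have "(\<Prod>i\<in>I. g (x i)) = exp (- t\<^sup>2 * q x / (2 * \<nu> * \<sigma>\<^sup>2))"
      unfolding g_def exp_sum[OF assms(3), symmetric]
      by (simp add: q_def sum_distrib_left sum_negf sum_divide_distrib)
    \<comment> \<open>At \<open>q x = 0\<close> both sides are 0: division by zero turns the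
      standard deviation into 0, and \<open>normal_density 0 0 t\<close> is 0 since its prefactor is
      \<open>1 / sqrt 0\<close>.\<close>
    then show ?thesis
      using \<nu> assms(1) q0[of x]
      by (cases "q x = 0")
         (simp_all add: normal_density_def K_def power_mult_distrib real_sqrt_mult real_sqrt_divide field_simps)
  qed
  \<comment> \<open>Each factor \<open>g\<close> receives an \<open>l\<close> so that it becomes a
    density of total mass 1 with respect to \<open>centered_normal \<sigma>\<close>; the powers of
    \<open>1 / l\<close> compensate.\<close>
  also have "\<dots> x = (1 / l) ^ card I * (sqrt (q x) / K * (\<Prod>i\<in>I. l * g (x i)))" for x
    using l by (simp add: prod.distrib power_divide)
  finally have eq: "normal_density 0 (\<sigma> * sqrt (\<nu> / q x)) t =
      (1 / l) ^ card I * (sqrt (q x) / K * (\<Prod>i\<in>I. l * g (x i)))" for x .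
  have lg: "l * g y \<ge> 0" for y
    using l by (simp add: g_def)
  have "ennreal (normal_density 0 (\<sigma> * sqrt (\<nu> / q x)) t) =
      ennreal ((1 / l) ^ card I) * ((\<Prod>i\<in>I. ennreal (l * g (x i))) * ennreal (sqrt (q x) / K))" for x
    unfolding eq prod_ennreal[OF lg] using l K q0[of x] prod_nonneg[of I "\<lambda>i. l * g (x i)"] lg
    by (simp add: ennreal_mult'[symmetric] ennreal_mult''[symmetric] mult_ac)
  then have "(\<integral>\<^sup>+x. ennreal (normal_density 0 (\<sigma> * sqrt (\<nu> / q x)) t) \<partial>?P \<sigma>) =
      (\<integral>\<^sup>+x. ennreal ((1 / l) ^ card I) * ((\<Prod>i\<in>I. ennreal (l * g (x i))) * ennreal (sqrt (q x) / K)) \<partial>?P \<sigma>)"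
    by simp
  also have "\<dots> = ennreal ((1 / l) ^ card I) * (\<integral>\<^sup>+x. (\<Prod>i\<in>I. ennreal (l * g (x i))) * ennreal (sqrt (q x) / K) \<partial>?P \<sigma>)"
    by (rule nn_integral_cmult) measurable
  also have "(\<integral>\<^sup>+x. (\<Prod>i\<in>I. ennreal (l * g (x i))) * ennreal (sqrt (q x) / K) \<partial>?P \<sigma>) =
      (\<integral>\<^sup>+x. ennreal (sqrt (q x) / K) \<partial>density (?P \<sigma>) (\<lambda>x. \<Prod>i\<in>I. ennreal (l * g (x i))))"
    by (rule nn_integral_density[symmetric]) measurable
  also have "density (?P \<sigma>) (\<lambda>x. \<Prod>i\<in>I. ennreal (l * g (x i))) = ?P (\<sigma> * (1 / l))"
  proof -
    have tilt: "density (centered_normal \<sigma>) (\<lambda>y. ennreal (l * g y)) = centered_normal (\<sigma> * (1 / l))"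
      using centered_normal_tilt[OF assms(1) \<nu>, of t] by (simp add: l_def g_def)
    show ?thesis
      by (subst density_PiM) (use assms l in \<open>simp_all add: tilt sig\<close>)
  qed
  \<comment> \<open>The tilted product is the original one scaled by \<open>1 / l\<close>, and this
    scaling takes one more factor \<open>1 / l\<close> out of \<open>sqrt (q x)\<close>.\<close>
  also have "\<dots> = distr (?P \<sigma>) (?P (\<sigma> * (1 / l))) (compose I (\<lambda>y. y * (1 / l)))"
  proof -
    have "distr (centered_normal \<sigma>) (centered_normal (\<sigma> * (1 / l))) (\<lambda>y. y * (1 / l)) =
        distr (centered_normal \<sigma>) borel (\<lambda>y. y * (1 / l))"
      by (rule distr_cong) simp_all
    also have "\<dots> = centered_normal (\<sigma> * (1 / l))"
      by (rule distr_centered_normal_mult) (use l assms(1) in simp_all)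
    finally have D: "distr (centered_normal \<sigma>) (centered_normal (\<sigma> * (1 / l))) (\<lambda>y. y * (1 / l)) =
        centered_normal (\<sigma> * (1 / l))" .
    have "distr (?P \<sigma>) (?P (\<sigma> * (1 / l))) (compose I (\<lambda>y. y * (1 / l))) =
        PiM I (\<lambda>_. distr (centered_normal \<sigma>) (centered_normal (\<sigma> * (1 / l))) (\<lambda>y. y * (1 / l)))"
      by (rule distr_PiM_finite_prob_space')
         (use l assms prob_space_centered_normal in auto)
    then show ?thesis
      unfolding D ..
  qed
  also have "(\<integral>\<^sup>+x. ennreal (sqrt (q x) / K) \<partial>\<dots>) = (\<integral>\<^sup>+x. ennreal (sqrt (q (compose I (\<lambda>y. y * (1 / l)) x)) / K) \<partial>?P \<sigma>)"
    by (rule nn_integral_distr) (unfold q_def compose_def, measurable)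
  also have "\<dots> = (\<integral>\<^sup>+x. ennreal (1 / l) * ennreal (sqrt (q x) / K) \<partial>?P \<sigma>)"
  proof (rule nn_integral_cong)
    fix x
    have "q (compose I (\<lambda>y. y * (1 / l)) x) = q x / l\<^sup>2"
      by (simp add: q_def compose_def power_divide sum_divide_distrib)
    then show "ennreal (sqrt (q (compose I (\<lambda>y. y * (1 / l)) x)) / K) = ennreal (1 / l) * ennreal (sqrt (q x) / K)"
      using l by (simp add: real_sqrt_divide ennreal_mult'[symmetric])
  qed
  also have "\<dots> = ennreal (1 / l) * (\<integral>\<^sup>+x. ennreal (sqrt (q x) / K) \<partial>?P \<sigma>)"
    by (rule nn_integral_cmult) measurable
  also have "ennreal ((1 / l) ^ card I) * (ennreal (1 / l) * (\<integral>\<^sup>+x. ennreal (sqrt (q x) / K) \<partial>?P \<sigma>)) =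
      (\<integral>\<^sup>+x. ennreal (sqrt (q x) / K) \<partial>?P \<sigma>) * ennreal ((1 + t\<^sup>2 / \<nu>) powr (- (\<nu> + 1) / 2))"
  proof -
    \<comment> \<open>\<open>\<nu>\<close> factors from the normalisation and one from the scaling:
      this is where the exponent \<open>\<nu> + 1\<close> of the Student density arises.\<close>
    have "(1 / l) ^ card I * (1 / l) = (1 / l) powr (\<nu> + 1)"
      using l by (simp add: assms(2) powr_add powr_realpow)
    also have "\<dots> = (1 + t\<^sup>2 / \<nu>) powr (- (\<nu> + 1) / 2)"
    proof -
      have "1 / l = (1 + t\<^sup>2 / \<nu>) powr (- 1 / 2)"
        using l2 by (simp add: l_def powr_half_sqrt[symmetric] powr_minus_divide)
      then show ?thesis
        by (simp only: powr_powr times_divide_eq_left mult_minus1)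
    qed
    finally have "ennreal ((1 / l) ^ card I * (1 / l)) = ennreal ((1 + t\<^sup>2 / \<nu>) powr (- (\<nu> + 1) / 2))"
      by (rule arg_cong)
    moreover have "ennreal ((1 / l) ^ card I) * ennreal (1 / l) = ennreal ((1 / l) ^ card I * (1 / l))"
      using l by (intro ennreal_mult[symmetric]) simp_all
    ultimately have "ennreal ((1 / l) ^ card I) * ennreal (1 / l) = ennreal ((1 + t\<^sup>2 / \<nu>) powr (- (\<nu> + 1) / 2))"
      by (simp only:)
    then show ?thesis
      unfolding mult.assoc[symmetric] by (rule ssubst) (rule mult.commute)
  qed
  finally show ?thesis
    unfolding q_def K_def .
qed

lemma sum_squares_pos_AE:
  assumes "\<sigma> > 0" "finite I" "I \<noteq> {}"
  shows "AE x in PiM I (\<lambda>_. centered_normal \<sigma>). (\<Sum>i\<in>I. (x i)\<^sup>2) > 0"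
proof -
  obtain i where i: "i \<in> I" using assms(3) by auto
  have "distr (PiM I (\<lambda>_. centered_normal \<sigma>)) (centered_normal \<sigma>) (\<lambda>x. x i) = centered_normal \<sigma>"
    by (rule distr_PiM_component) (use prob_space_centered_normal[OF assms(1)] i in auto)
  then have "AE y in distr (PiM I (\<lambda>_. centered_normal \<sigma>)) (centered_normal \<sigma>) (\<lambda>x. x i). y \<noteq> 0"
    using AE_centered_normal_neq_0[of \<sigma>] by (simp only:)
  then have "AE x in PiM I (\<lambda>_. centered_normal \<sigma>). x i \<noteq> 0"
    using i by (subst (asm) AE_distr_iff) auto
  then show ?thesis
    by (rule eventually_mono)
       (use assms i in \<open>auto intro!: sum_pos2[where i=i]\<close>)
qed

text \<open>Given the coordinates in \<open>I\<close> the ratio is a scaled normal variable. Mixing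
  over them gives a constant times the Student kernel, and the constant is fixed by total mass 1
  instead of being computed.\<close>

lemma distr_normal_ratio_student:
  fixes \<sigma> \<nu> :: real
  assumes "\<sigma> > 0" "\<nu> = real (card I)" "finite I" "I \<noteq> {}" "z \<notin> I"
  shows "distr (PiM (insert z I) (\<lambda>_. centered_normal \<sigma>)) borel (\<lambda>x. x z * sqrt (\<nu> / (\<Sum>i\<in>I. (x i)\<^sup>2))) =
    density lborel (\<lambda>t. ennreal (student_t_density \<nu> t))"
proof -
  let ?P = "\<lambda>I. PiM I (\<lambda>_. centered_normal \<sigma>)"
  let ?T = "\<lambda>x. x z * sqrt (\<nu> / (\<Sum>i\<in>I. (x i)\<^sup>2))"
  let ?k = "\<lambda>t. ennreal ((1 + t\<^sup>2 / \<nu>) powr (- (\<nu> + 1) / 2))"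
  let ?sd = "\<lambda>x. \<sigma> * sqrt (\<nu> / (\<Sum>i\<in>I. (x i)\<^sup>2))"
  define C where "C = (\<integral>\<^sup>+x. ennreal (sqrt (\<Sum>i\<in>I. (x i)\<^sup>2) / (\<sigma> * sqrt (2 * pi * \<nu>))) \<partial>?P I)"
  interpret N: product_sigma_finite "\<lambda>_. centered_normal \<sigma>"
    using prob_space_centered_normal[OF assms(1)]
    by (simp add: product_sigma_finite_def prob_space_imp_sigma_finite)
  interpret PI: prob_space "?P I"
    by (rule prob_space_PiM_centered_normal[OF assms(1)])
  interpret PzI: prob_space "?P (insert z I)"
    by (rule prob_space_PiM_centered_normal[OF assms(1)])
  have \<nu>: "\<nu> > 0"
    using assms by (simp add: card_gt_0_iff)
  have T [measurable]: "?T \<in> borel_measurable (?P (insert z I))"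
    by measurable
  have key: "distr (?P (insert z I)) borel ?T = density lborel (\<lambda>t. C * ?k t)"
  proof (rule measure_eqI)
    fix A assume "A \<in> sets (distr (?P (insert z I)) borel ?T)"
    then have A [measurable]: "A \<in> sets borel" by simp
    have "emeasure (distr (?P (insert z I)) borel ?T) A = (\<integral>\<^sup>+t. indicator A t \<partial>distr (?P (insert z I)) borel ?T)"
      by simp
    also have "\<dots> = (\<integral>\<^sup>+x. indicator A (?T x) \<partial>?P (insert z I))"
      by (rule nn_integral_distr) measurable
    also have "\<dots> = (\<integral>\<^sup>+x. \<integral>\<^sup>+y. indicator A (?T (x(z := y))) \<partial>centered_normal \<sigma> \<partial>?P I)"
      by (rule N.product_nn_integral_insert) (use assms in measurable)
    also have "\<dots> = (\<integral>\<^sup>+x. \<integral>\<^sup>+t. ennreal (normal_density 0 (?sd x) t) * indicator A t \<partial>lborel \<partial>?P I)"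
    \<comment> \<open>Scaling needs a positive factor, so the null set on which the sum of squares
      vanishes is discarded.\<close>
    proof (rule nn_integral_cong_AE, rule eventually_mono[OF sum_squares_pos_AE[OF assms(1,3,4)]])
      fix x :: "'a \<Rightarrow> real" assume "(\<Sum>i\<in>I. (x i)\<^sup>2) > 0"
      then have c: "sqrt (\<nu> / (\<Sum>i\<in>I. (x i)\<^sup>2)) > 0" (is "?c > 0")
        using \<nu> by simp
      have "(\<Sum>i\<in>I. ((x(z := y)) i)\<^sup>2) = (\<Sum>i\<in>I. (x i)\<^sup>2)" for y
        using assms(5) by (intro sum.cong) auto
      then have "(\<integral>\<^sup>+y. indicator A (?T (x(z := y))) \<partial>centered_normal \<sigma>) = (\<integral>\<^sup>+y. indicator A (y * ?c) \<partial>centered_normal \<sigma>)"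
        by simp
      also have "\<dots> = (\<integral>\<^sup>+t. indicator A t \<partial>centered_normal (\<sigma> * ?c))"
        unfolding distr_centered_normal_mult[OF assms(1) c, symmetric]
        by (rule nn_integral_distr[symmetric]) measurable
      finally show "(\<integral>\<^sup>+y. indicator A (?T (x(z := y))) \<partial>centered_normal \<sigma>) =
          (\<integral>\<^sup>+t. ennreal (normal_density 0 (?sd x) t) * indicator A t \<partial>lborel)"
        by (simp add: centered_normal_def nn_integral_density del: nn_integral_indicator)
    qed
    also have "\<dots> = (\<integral>\<^sup>+t. \<integral>\<^sup>+x. ennreal (normal_density 0 (?sd x) t) * indicator A t \<partial>?P I \<partial>lborel)"
    proof -
      interpret pair_sigma_finite "?P I" lborel ..
      show ?thesis
        by (rule Fubini'[symmetric]) (unfold normal_density_def, measurable)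
    qed
    also have "\<dots> = (\<integral>\<^sup>+t. C * ?k t * indicator A t \<partial>lborel)"
    proof (rule nn_integral_cong)
      fix t
      have "(\<integral>\<^sup>+x. ennreal (normal_density 0 (?sd x) t) * indicator A t \<partial>?P I) =
          (\<integral>\<^sup>+x. ennreal (normal_density 0 (?sd x) t) \<partial>?P I) * indicator A t"
        by (rule nn_integral_multc) (unfold normal_density_def, measurable)
      then show "(\<integral>\<^sup>+x. ennreal (normal_density 0 (?sd x) t) * indicator A t \<partial>?P I) = C * ?k t * indicator A t"
        by (simp only: nn_integral_normal_scale_mixture[OF assms(1-4)] C_def)
    qed
    also have "\<dots> = emeasure (density lborel (\<lambda>t. C * ?k t)) A"
      by (simp add: emeasure_density)
    finally show "emeasure (distr (?P (insert z I)) borel ?T) A = emeasure (density lborel (\<lambda>t. C * ?k t)) A" .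
  qed simp
  define J where "J = sqrt (\<nu> * pi) * Gamma (\<nu> / 2) / Gamma ((\<nu> + 1) / 2)"
  have J: "J > 0"
    using \<nu> by (simp add: J_def Gamma_real_pos)
  \<comment> \<open>A law has mass 1, so \<open>C\<close> is the reciprocal of the known integral
    \<open>J\<close> of the kernel.\<close>
  have "1 = emeasure (density lborel (\<lambda>t. C * ?k t)) (space (density lborel (\<lambda>t. C * ?k t)))"
    unfolding key[symmetric] using prob_space.emeasure_space_1[OF PzI.prob_space_distr[OF T]] by simp
  also have "\<dots> = C * ennreal J"
    using nn_integral_student_kernel[OF \<nu>] by (simp add: emeasure_density nn_integral_cmult J_def)
  finally have "C * ennreal J * ennreal (1 / J) = ennreal (1 / J)"
    by simp
  then have C: "C = ennreal (1 / J)"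
    using J by (simp add: mult.assoc ennreal_mult'[symmetric])
  have "C * ?k t = ennreal (1 / J * (1 + t\<^sup>2 / \<nu>) powr (- (\<nu> + 1) / 2))" for t
    using J unfolding C by (intro ennreal_mult'[symmetric]) simp
  then have "C * ?k t = ennreal (student_t_density \<nu> t)" for t
    by (simp add: student_t_density_def J_def)
  then show ?thesis
    unfolding key by simp
qed

section \<open>Inverse Gram matrices\<close>

lemma matrix_inv_left_inverse:
  fixes A :: "real ^ 'n ^ 'n"
  assumes "invertible A"
  shows "matrix_inv A ** A = mat 1"
  using someI_ex[OF assms[unfolded invertible_def]] unfolding matrix_inv_def by blast

lemma invertible_gram:
  fixes G :: "real ^ 'p ^ 'k"
  assumes "inj ((*v) G)"
  shows "invertible (transpose G ** G)"
proof -
  have "x = 0" if "(transpose G ** G) *v x = 0" for x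
  proof -
    have "(G *v x) \<bullet> (G *v x) = x \<bullet> (transpose G *v (G *v x))"
      by (simp add: dot_lmul_matrix inner_commute[of x])
    also have "\<dots> = 0"
      using that by (simp add: matrix_vector_mul_assoc)
    finally show ?thesis
      using injD[OF assms, of x 0] by simp
  qed
  then show ?thesis
    using matrix_left_invertible_ker[of "transpose G ** G"] invertible_left_inverse by blast
qed

text \<open>The normal equations in weak form: a guessed \<open>w\<close> is verified by testing
  against every \<open>x\<close>, so the inverse never has to be computed.\<close>

lemma matrix_inv_gram_mult_eqI:
  fixes G :: "real ^ 'p ^ 'k"
  assumes "inj ((*v) G)" "\<And>x. (G *v x) \<bullet> (G *v w) = x \<bullet> b"
  shows "matrix_inv (transpose G ** G) *v b = w"
proof -
  have "x \<bullet> (transpose G *v (G *v w)) = x \<bullet> b" for x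
    using assms(2)[of x] by (simp add: dot_lmul_matrix inner_commute[of x] inner_commute[of "G *v x"])
  then have "(transpose G ** G) *v w = b"
    by (metis vector_eq_rdot inner_commute matrix_vector_mul_assoc)
  then show ?thesis
    using matrix_inv_left_inverse[OF invertible_gram[OF assms(1)]]
    by (metis matrix_vector_mul_assoc matrix_vector_mul_lid)
qed

text \<open>Cramer's rule gives a quotient of polynomials where the determinant is nonzero;
  elsewhere the value is constant.\<close>

lemma borel_measurable_matrix_inv_mult:
  fixes f :: "'a \<Rightarrow> real ^ 'p ^ 'p"
  assumes f: "\<And>i j. (\<lambda>x. f x $ i $ j) \<in> borel_measurable M"
  shows "(\<lambda>x. (matrix_inv (f x) *v b) $ k) \<in> borel_measurable M"
proof -
  have det: "(\<lambda>x. det (g x)) \<in> borel_measurable M"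
    if "\<And>i j. (\<lambda>x. g x $ i $ j) \<in> borel_measurable M" for g :: "'a \<Rightarrow> real ^ 'p ^ 'p"
    unfolding det_def
    by (intro borel_measurable_sum borel_measurable_times borel_measurable_const borel_measurable_prod that)
  \<comment> \<open>For every singular matrix the predicate under the choice operator is everywhere
    false, so the choice is always the same matrix.\<close>
  have sing: "matrix_inv A = matrix_inv 0" if "det A = 0" for A :: "real ^ 'p ^ 'p"
  proof -
    have "\<not> invertible (0 :: real ^ 'p ^ 'p)"
      using inj_matrix_vector_mult[of "0 :: real ^ 'p ^ 'p"] injD[of "(*v) (0 :: real ^ 'p ^ 'p)" 1 0]
      by auto
    moreover have "\<not> invertible A"
      using that by (simp add: invertible_det_nz)
    ultimately have "(\<lambda>B. A ** B = mat 1 \<and> B ** A = mat 1) = (\<lambda>B. 0 ** B = mat 1 \<and> B ** 0 = (mat 1 :: real ^ 'p ^ 'p))"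
      unfolding invertible_def by blast
    then show ?thesis
      by (simp only: matrix_inv_def)
  qed
  have "(matrix_inv (f x) *v b) $ k =
      (if det (f x) = 0 then (matrix_inv 0 *v b) $ k
       else det (\<chi> i j. if j = k then b $ i else f x $ i $ j) / det (f x))" for x
  proof (cases "det (f x) = 0")
    case False
    then have "f x *v (matrix_inv (f x) *v b) = b"
      using matrix_inv_left_inverse[of "f x"]
      by (metis invertible_det_nz matrix_left_right_inverse matrix_vector_mul_assoc matrix_vector_mul_lid)
    then have "matrix_inv (f x) *v b = (\<chi> k. det (\<chi> i j. if j = k then b $ i else f x $ i $ j) / det (f x))"
      by (simp only: cramer[OF False])
    then show ?thesis
      using False by simp
  qed (simp add: sing)
  moreover have "(\<lambda>x. det (\<chi> i j. if j = k then b $ i else f x $ i $ j)) \<in> borel_measurable M"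
    by (rule det, rename_tac i j, case_tac "j = k") (simp_all add: f)
  ultimately show ?thesis
    using det[OF f] by simp
qed

text \<open>\<open>B\<close> is an orthonormal basis of the orthogonal complement of
  \<open>V\<close>. The last property makes the sum over \<open>B\<close> the component of
  \<open>z\<close> orthogonal to \<open>V\<close>.\<close>

lemma subspace_complement_frame:
  fixes V :: "'a::euclidean_space set"
  assumes "subspace V"
  obtains B where "finite B" "card B = DIM('a) - dim V"
    "\<And>d e. d \<in> B \<Longrightarrow> e \<in> B \<Longrightarrow> d \<bullet> e = (if d = e then 1 else 0)"
    "\<And>x e. x \<in> V \<Longrightarrow> e \<in> B \<Longrightarrow> x \<bullet> e = 0"
    "\<And>z. z - (\<Sum>e\<in>B. (z \<bullet> e) *\<^sub>R e) \<in> V"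
proof -
  define W where "W = {y \<in> UNIV. \<forall>x\<in>V. orthogonal x y}"
  have "subspace W"
    by (auto simp: W_def subspace_def orthogonal_def inner_simps)
  then obtain B where B: "B \<subseteq> W" "pairwise orthogonal B" "\<And>x. x \<in> B \<Longrightarrow> norm x = 1"
      "independent B" "card B = dim W" "span B = W"
    by (rule orthonormal_basis_subspace) blast
  have fin: "finite B"
    using B(4) by (rule independent_imp_finite)
  have orth: "x \<bullet> e = 0" if "x \<in> V" "e \<in> B" for x e
    using B(1) that by (auto simp: W_def orthogonal_def)
  show thesis
  proof (rule that[OF fin _ _ orth])
    show "card B = DIM('a) - dim V"
      using dim_subspace_orthogonal_to_vectors[OF assms subspace_UNIV] B(5) by (simp add: W_def)
    show "d \<bullet> e = (if d = e then 1 else 0)" if "d \<in> B" "e \<in> B" for d e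
      using that B(2,3) by (auto simp: pairwise_def orthogonal_def norm_eq_1)
    show "z - (\<Sum>e\<in>B. (z \<bullet> e) *\<^sub>R e) \<in> V" for z
    proof -
      obtain y w where yw: "y \<in> span V" "\<And>x. x \<in> span V \<Longrightarrow> orthogonal w x" "z = y + w"
        using orthogonal_subspace_decomp_exists[of V z] by metis
      have y: "y \<in> V"
        using yw(1) assms by (metis span_eq_iff)
      have "w \<in> span B"
        unfolding B(6) W_def using yw(2) by (auto simp: span_base orthogonal_commute)
      then have "(\<Sum>e\<in>B. (w \<bullet> e) *\<^sub>R e) = w"
        by (intro orthonormal_basis_expand B(2,3) fin)
      moreover have "z \<bullet> e = w \<bullet> e" if "e \<in> B" for e
        using orth[OF y that] yw(3) by (simp add: inner_add_left)
      ultimately show ?thesis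
        using yw(3) y by (simp cong: sum.cong)
    qed
  qed
qed

text \<open>Riesz representation on the image of \<open>K\<close>: injectivity transports the
  functional \<open>x \<bullet> b\<close> there through a left inverse \<open>g\<close>, and
  projecting \<open>adjoint g b\<close> onto the image gives the representer.\<close>

lemma inner_on_subspace_representer:
  fixes f :: "'a::euclidean_space \<Rightarrow> 'b::euclidean_space"
  assumes "linear f" "subspace K" "inj_on f K"
  obtains s where "s \<in> f ` K" "\<And>x. x \<in> K \<Longrightarrow> f x \<bullet> s = x \<bullet> b"
proof -
  obtain g where g: "linear g" "\<And>x. x \<in> K \<Longrightarrow> g (f x) = x"
    using linear_exists_left_inverse_on[OF assms] by blast
  have V: "subspace (f ` K)"
    using assms by (intro linear_subspace_image)
  obtain s t where st: "s \<in> span (f ` K)" "\<And>w. w \<in> span (f ` K) \<Longrightarrow> orthogonal t w" "adjoint g b = s + t"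
    using orthogonal_subspace_decomp_exists[of "f ` K" "adjoint g b"] by metis
  show thesis
  proof (rule that)
    show "s \<in> f ` K"
      using st(1) V by (metis span_eq_iff)
    fix x assume x: "x \<in> K"
    have "f x \<bullet> t = 0"
      using st(2)[of "f x"] x by (auto simp: orthogonal_def inner_commute span_base)
    then have "f x \<bullet> s = f x \<bullet> adjoint g b"
      by (simp add: st(3) inner_add_right)
    also have "\<dots> = x \<bullet> b"
      using adjoint_works[OF g(1)] g(2)[OF x] by simp
    finally show "f x \<bullet> s = x \<bullet> b" .
  qed
qed

text \<open>On \<open>m\<^sup>\<bottom>\<close> the quadratic form of \<open>G\<close> sees only \<open>G\<close> restricted to that hyperplane, and the direction \<open>c\<close>
  contributes one further vector \<open>z\<close>; \<open>r\<close> is the part of \<open>z\<close> orthogonal to \<open>G m\<^sup>\<bottom>\<close>.\<close>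

lemma inverse_gram_quadratic_forms:
  fixes G :: "real ^ 'p ^ 'k"
  assumes inj: "inj ((*v) G)" and q: "q > 0" "m \<bullet> c = q\<^sup>2" "b \<bullet> c = 0"
    and z: "G *v c = q *\<^sub>R z" "z = G *v xz + r" "m \<bullet> xz = 0"
    and r: "\<And>x. m \<bullet> x = 0 \<Longrightarrow> (G *v x) \<bullet> r = 0"
    and s: "s = G *v xs" "m \<bullet> xs = 0" "\<And>x. m \<bullet> x = 0 \<Longrightarrow> (G *v x) \<bullet> s = x \<bullet> b"
  defines "A \<equiv> matrix_inv (transpose G ** G)"
  shows "r \<noteq> 0"
    and "m \<bullet> (A *v b) = - (q * (z \<bullet> s) / (r \<bullet> r))"
    and "b \<bullet> (A *v b) = s \<bullet> s + (z \<bullet> s)\<^sup>2 / (r \<bullet> r)"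
    and "m \<bullet> (A *v m) = q\<^sup>2 / (r \<bullet> r)"
proof -
  \<comment> \<open>Correcting \<open>c\<close> inside the hyperplane removes from
    \<open>G *v c\<close> everything but the multiple \<open>q\<close> of \<open>r\<close>, so
    \<open>c'\<close> is orthogonal to the hyperplane in the quadratic form of
    \<open>G\<close>.\<close>
  define c' where "c' = c - q *\<^sub>R xz"
  have Gc': "G *v c' = q *\<^sub>R r"
    using z by (simp add: c'_def matrix_vector_mult_diff_distrib matrix_vector_mult_scaleR scaleR_right_distrib)
  have mc': "m \<bullet> c' = q\<^sup>2"
    using q z by (simp add: c'_def inner_diff_right)
  show r0: "r \<noteq> 0"
  proof
    assume "r = 0"
    then have "c' = 0"
      using Gc' injD[OF inj, of c' 0] by simp
    then show False
      using mc' q by simp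
  qed
  then have R: "r \<bullet> r > 0"
    by simp
  have rs: "r \<bullet> s = 0"
    using r[OF s(2)] s(1) by (simp add: inner_commute)
  have zs: "z \<bullet> s = xz \<bullet> b"
    using s(3)[OF z(3)] rs by (simp add: z(2) inner_add_left)
  have bc': "c' \<bullet> b = - (q * (z \<bullet> s))"
    using q zs by (simp add: c'_def inner_diff_left inner_diff_right inner_commute[of _ b])
  \<comment> \<open>Since \<open>m \<bullet> c'\<close> is nonzero, \<open>c'\<close> spans a
    complement of the hyperplane; both weak equations below are tested on these two pieces.\<close>
  have split: "\<exists>y. m \<bullet> y = 0 \<and> x = y + (m \<bullet> x / q\<^sup>2) *\<^sub>R c'" for x
    by (rule exI[of _ "x - (m \<bullet> x / q\<^sup>2) *\<^sub>R c'"]) (use q mc' in \<open>simp add: inner_diff_right\<close>)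
  have Am: "A *v m = (1 / (r \<bullet> r)) *\<^sub>R c'"
    unfolding A_def
  proof (rule matrix_inv_gram_mult_eqI[OF inj])
    fix x
    obtain y where y: "m \<bullet> y = 0" "x = y + (m \<bullet> x / q\<^sup>2) *\<^sub>R c'"
      using split by blast
    have "(G *v x) \<bullet> r = (m \<bullet> x / q\<^sup>2) * (q * (r \<bullet> r))"
      by (subst y(2)) (use r[OF y(1)] in \<open>simp add: matrix_vector_right_distrib matrix_vector_mult_scaleR Gc' inner_add_left\<close>)
    then show "(G *v x) \<bullet> (G *v (1 / (r \<bullet> r)) *\<^sub>R c') = x \<bullet> m"
      using R q by (simp add: matrix_vector_mult_scaleR Gc' inner_commute power2_eq_square)
  qed
  \<comment> \<open>Testing against \<open>c'\<close> demands
    \<open>\<beta> * q\<^sup>2 * (r \<bullet> r) = c' \<bullet> b\<close>; this is the solution.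
    Testing against the hyperplane is met by \<open>xs\<close>.\<close>
  define \<beta> where "\<beta> = - (z \<bullet> s) / (q * (r \<bullet> r))"
  have Ab: "A *v b = xs + \<beta> *\<^sub>R c'"
    unfolding A_def
  proof (rule matrix_inv_gram_mult_eqI[OF inj])
    fix x
    obtain y where y: "m \<bullet> y = 0" "x = y + (m \<bullet> x / q\<^sup>2) *\<^sub>R c'"
      using split by blast
    define \<tau> where "\<tau> = m \<bullet> x / q\<^sup>2"
    have x: "x = y + \<tau> *\<^sub>R c'"
      using y(2) by (simp add: \<tau>_def)
    have "G *v (xs + \<beta> *\<^sub>R c') = s + (\<beta> * q) *\<^sub>R r"
      by (simp add: matrix_vector_right_distrib matrix_vector_mult_scaleR Gc' s(1))
    moreover have "G *v x = G *v y + (\<tau> * q) *\<^sub>R r"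
      by (simp add: x matrix_vector_right_distrib matrix_vector_mult_scaleR Gc')
    ultimately have "(G *v x) \<bullet> (G *v (xs + \<beta> *\<^sub>R c')) = y \<bullet> b + \<tau> * q * (\<beta> * q) * (r \<bullet> r)"
      using r[OF y(1)] s(3)[OF y(1)] rs
      by (simp add: inner_add_left inner_add_right)
    also have "\<dots> = x \<bullet> b"
      using R q by (simp add: x inner_add_left bc' \<beta>_def)
    finally show "(G *v x) \<bullet> (G *v (xs + \<beta> *\<^sub>R c')) = x \<bullet> b" .
  qed
  show "m \<bullet> (A *v b) = - (q * (z \<bullet> s) / (r \<bullet> r))"
    using q s(2) mc' by (simp add: Ab inner_add_right inner_diff_right \<beta>_def power2_eq_square)
  have "b \<bullet> xs = s \<bullet> s"
    using s(3)[OF s(2)] s(1) by (simp add: inner_commute)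
  then show "b \<bullet> (A *v b) = s \<bullet> s + (z \<bullet> s)\<^sup>2 / (r \<bullet> r)"
    using bc' q by (simp add: Ab inner_add_right inner_diff_right inner_commute[of _ b] \<beta>_def power2_eq_square)
  show "m \<bullet> (A *v m) = q\<^sup>2 / (r \<bullet> r)"
    by (simp add: Am mc')
qed

text \<open>Under the root the terms in \<open>t\<close> cancel and leave
  \<open>(\<gamma> * q * s)\<^sup>2 / R\<close>. Hence \<open>\<gamma>\<close> and \<open>q\<close>
  drop out.\<close>

lemma studentized_ratio_eq:
  fixes \<gamma> q R \<nu> t s :: real
  assumes "\<gamma> > 0" "q > 0" "R > 0" "s > 0" "\<nu> > 0"
  shows "\<gamma> * - (q * t / R) * sqrt (\<nu> / (\<gamma> * (s\<^sup>2 + t\<^sup>2 / R) * \<gamma> * (q\<^sup>2 / R) - (\<gamma> * - (q * t / R))\<^sup>2)) =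
    - (t / s) * sqrt (\<nu> / R)"
proof -
  define w where "w = sqrt R"
  have w: "w > 0" "R = w\<^sup>2"
    using assms(3) by (simp_all add: w_def)
  have "\<gamma> * (s\<^sup>2 + t\<^sup>2 / R) * \<gamma> * (q\<^sup>2 / R) - (\<gamma> * - (q * t / R))\<^sup>2 = (\<gamma> * q * s)\<^sup>2 / w\<^sup>2"
    using w by (simp add: field_simps power2_eq_square)
  moreover have "sqrt (\<nu> / ((\<gamma> * q * s)\<^sup>2 / w\<^sup>2)) = sqrt \<nu> * w / (\<gamma> * q * s)"
    using assms w by (simp add: real_sqrt_divide real_sqrt_mult)
  moreover have "sqrt (\<nu> / R) = sqrt \<nu> / w"
    using w by (simp add: real_sqrt_divide)
  moreover have "\<gamma> * - (q * t / R) * (sqrt \<nu> * w / (\<gamma> * q * s)) = - (t / s) * (sqrt \<nu> / w)"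
    using assms w by (simp add: power2_eq_square)
  ultimately show ?thesis
    by (simp only:)
qed

section \<open>Resampling a sketch along one direction\<close>

text \<open>The rank-one matrix of column \<open>w\<close> times row \<open>a\<close>.\<close>

definition outer :: "real ^ 'k \<Rightarrow> real ^ 'n \<Rightarrow> real ^ 'n ^ 'k" where
  "outer w a = (\<chi> i. w $ i *\<^sub>R a)"

text \<open>Projects every row of \<open>U\<close> to the line of \<open>a\<close>. For a unit
  vector \<open>a\<close> it is an orthogonal projection of matrix space, as the resampling identity
  requires.\<close>

definition row_proj :: "real ^ 'n \<Rightarrow> real ^ 'n ^ 'k \<Rightarrow> real ^ 'n ^ 'k" where
  "row_proj a U = outer (U *v a) a"

lemma matrix_vector_mult_nth_inner: "(U *v x) $ i = U $ i \<bullet> x" for x :: "real ^ 'n"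
  by (simp add: matrix_vector_mult_def inner_vec_def)

text \<open>Coordinates of the vector \<open>U *v a\<close> are thereby coordinates of the matrix
  \<open>U\<close> itself, so Gaussian facts about matrices apply to them.\<close>

lemma inner_outer: "U \<bullet> outer w a = w \<bullet> (U *v a)"
  by (simp add: inner_vec_def[of U] inner_vec_def[of w] outer_def matrix_vector_mult_nth_inner)

lemma outer_mult_vector: "outer w a *v x = (a \<bullet> x) *\<^sub>R w"
  by (simp add: vec_eq_iff matrix_vector_mult_nth_inner outer_def)

lemma linear_row_proj: "linear (row_proj a)"
  by (rule linearI)
     (simp_all add: row_proj_def outer_def vec_eq_iff matrix_vector_mult_nth_inner inner_add_left algebra_simps)

lemma row_proj_idem: "norm a = 1 \<Longrightarrow> row_proj a (row_proj a U) = row_proj a U"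
  by (simp add: row_proj_def outer_mult_vector norm_eq_1)

lemma row_proj_self_adjoint: "row_proj a U \<bullet> W = U \<bullet> row_proj a W"
  by (simp add: row_proj_def inner_outer inner_commute)

lemma resample_mult_vector:
  "(v - row_proj a v + row_proj a u) *v x = (v - row_proj a v) *v x + (a \<bullet> x) *\<^sub>R (u *v a)"
  by (simp add: matrix_vector_mult_add_rdistrib row_proj_def outer_mult_vector)

lemma row_proj_complement_mult_vector: "norm a = 1 \<Longrightarrow> (v - row_proj a v) *v a = 0"
  by (simp add: matrix_vector_mult_diff_rdistrib row_proj_def outer_mult_vector norm_eq_1)

text \<open>The resampling identity for the indicator of \<open>N\<close>, since a nonnegative
  integral vanishes exactly when its integrand does almost everywhere.\<close>

lemma AE_gauss_resample_iff:
  fixes P :: "'a::euclidean_space \<Rightarrow> 'a"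
  assumes "\<sigma> > 0" and P: "linear P" "\<And>x. P (P x) = P x" "\<And>x y. P x \<bullet> y = x \<bullet> P y"
    and N [measurable]: "N \<in> sets borel"
  shows "(AE x in gauss \<sigma>. x \<notin> N) \<longleftrightarrow> (AE v in gauss \<sigma>. AE u in gauss \<sigma>. v - P v + P u \<notin> N)"
proof -
  have P_meas [measurable]: "P \<in> borel_measurable borel"
    by (rule borel_measurable_linear[OF P(1)])
  interpret prob_space "gauss \<sigma> :: 'a measure"
    by (rule prob_space_gauss[OF assms(1)])
  have "(AE x in gauss \<sigma>. x \<notin> N) \<longleftrightarrow> (\<integral>\<^sup>+x. indicator N x \<partial>gauss \<sigma>) = 0"
    by (subst nn_integral_0_iff_AE) (auto simp: indicator_eq_0_iff)
  also have "\<dots> \<longleftrightarrow> (\<integral>\<^sup>+v. \<integral>\<^sup>+u. indicator N (v - P v + P u) \<partial>gauss \<sigma> \<partial>gauss \<sigma>) = 0"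
    by (subst nn_integral_gauss_resample[OF assms(1) P]) simp_all
  also have "\<dots> \<longleftrightarrow> (AE v in gauss \<sigma>. (\<integral>\<^sup>+u. indicator N (v - P v + P u) \<partial>gauss \<sigma>) = 0)"
    by (rule nn_integral_0_iff_AE) measurable
  also have "\<dots> \<longleftrightarrow> (AE v in gauss \<sigma>. AE u in gauss \<sigma>. v - P v + P u \<notin> N)"
    by (subst nn_integral_0_iff_AE) (auto simp: indicator_eq_0_iff)
  finally show ?thesis .
qed

text \<open>A unit vector \<open>w\<close> orthogonal to \<open>V\<close> exists by the dimension
  bound, and the coordinate of \<open>u *v a\<close> along it is a nondegenerate normal
  variable.\<close>

lemma AE_gauss_mult_notin_subspace:
  fixes V :: "(real ^ 'k) set" and a :: "real ^ 'n"
  assumes "\<sigma> > 0" "norm a = 1" "dim V < CARD('k)"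
  shows "AE u in (gauss \<sigma> :: (real ^ 'n ^ 'k) measure). u *v a \<notin> V"
proof -
  obtain w' where w': "w' \<noteq> 0" "\<And>y. y \<in> span V \<Longrightarrow> orthogonal w' y"
    using orthogonal_to_subspace_exists[of V] assms(3) by auto
  define w where "w = w' /\<^sub>R norm w'"
  have w: "norm w = 1" "\<And>y. y \<in> V \<Longrightarrow> w \<bullet> y = 0"
    using w' by (auto simp: w_def orthogonal_def span_base)
  have "outer w a \<bullet> outer w a = 1"
    using w(1) assms(2) by (simp add: inner_outer outer_mult_vector norm_eq_1)
  then have e: "norm (outer w a) = 1"
    by (simp add: norm_eq_1)
  have "AE y in distr (gauss \<sigma>) borel (\<lambda>u. u \<bullet> outer w a). y \<noteq> 0"
    by (simp only: distr_gauss_inner[OF assms(1) e] AE_centered_normal_neq_0)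
  then have "AE u in gauss \<sigma>. u \<bullet> outer w a \<noteq> 0"
    by (subst (asm) AE_distr_iff) simp_all
  then show ?thesis
    by (rule eventually_mono) (use w(2) in \<open>auto simp: inner_outer\<close>)
qed

text \<open>If the columns of \<open>S ** X\<close> are dependent, one of them is a combination of the others.  Resampling \<open>S\<close>
  along the direction dual to that column makes it a free Gaussian vector, which avoids every fixed proper
  subspace.\<close>

lemma AE_gauss_inj_mult:
  fixes X :: "real ^ 'p ^ 'n"
  assumes "\<sigma> > 0" "inj ((*v) X)" "CARD('p) < CARD('k)"
  shows "AE S in (gauss \<sigma> :: (real ^ 'n ^ 'k) measure). inj ((*v) (S ** X))"
    and "{S :: real ^ 'n ^ 'k. \<not> inj ((*v) (S ** X))} \<in> sets borel"
proof -
  \<comment> \<open>A nonzero kernel vector divided by an entry of largest absolute value lies in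
    some \<open>C j\<close>. As \<open>C j\<close> is compact, \<open>N j\<close> is the projection
    of a closed set along a compact factor, hence closed and measurable.\<close>
  define C where "C j = {c :: real ^ 'p. c $ j = 1 \<and> (\<forall>i. \<bar>c $ i\<bar> \<le> 1)}" for j
  define N where "N j = {S :: real ^ 'n ^ 'k. \<exists>c. c \<in> C j \<and> (c, S) \<in> {z. snd z *v (X *v fst z) = 0}}" for j
  have "closed (N j)" for j
    unfolding N_def
  proof (rule closed_compact_projection)
    have "closed (C j)"
      unfolding C_def
      by (intro closed_Collect_conj closed_Collect_all closed_Collect_eq closed_Collect_le continuous_intros)
    moreover have "bounded (C j)"
    proof (rule boundedI)
      fix c assume "c \<in> C j"
      then have "(\<Sum>i\<in>UNIV. \<bar>c $ i\<bar>) \<le> (\<Sum>i\<in>(UNIV :: 'p set). 1)"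
        by (intro sum_mono) (simp add: C_def)
      then show "norm c \<le> (\<Sum>i\<in>(UNIV :: 'p set). 1)"
        using norm_le_l1_cart[of c] by linarith
    qed
    ultimately show "compact (C j)"
      by (simp add: compact_eq_bounded_closed)
    have "{z :: (real ^ 'p) \<times> (real ^ 'n ^ 'k). snd z *v (X *v fst z) = 0} =
        {z. \<forall>i. (snd z $ i) \<bullet> (X *v fst z) = 0}"
      by (auto simp: vec_eq_iff matrix_vector_mult_nth_inner)
    also have "closed \<dots>"
      by (intro closed_Collect_all closed_Collect_eq continuous_intros
            bounded_linear.continuous_on[OF matrix_vector_mul_bounded_linear])
    finally show "closed {z :: (real ^ 'p) \<times> (real ^ 'n ^ 'k). snd z *v (X *v fst z) = 0}" .
  qed
  then have N_sets [measurable]: "N j \<in> sets borel" for j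
    by (rule borel_closed)
  have "{S. \<not> inj ((*v) (S ** X))} = (\<Union>j. N j)"
  proof (intro set_eqI iffI)
    fix S :: "real ^ 'n ^ 'k"
    assume "S \<in> {S. \<not> inj ((*v) (S ** X))}"
    then obtain x where x: "(S ** X) *v x = 0" "x \<noteq> 0"
      by (metis matrix_left_invertible_injective matrix_left_invertible_ker mem_Collect_eq)
    have "Max (range (\<lambda>i. \<bar>x $ i\<bar>)) \<in> range (\<lambda>i. \<bar>x $ i\<bar>)"
      by (intro Max_in) auto
    then obtain j where j: "\<bar>x $ j\<bar> = Max (range (\<lambda>i. \<bar>x $ i\<bar>))"
      by force
    then have le: "\<bar>x $ i\<bar> \<le> \<bar>x $ j\<bar>" for i
      by (metis Max_ge finite_imageI finite_code rangeI)
    have xj: "x $ j \<noteq> 0"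
      using x(2) le by (auto simp: vec_eq_iff)
    have "inverse (x $ j) *\<^sub>R x \<in> C j"
      using xj le by (auto simp: C_def abs_mult field_simps)
    moreover have "S *v (X *v (inverse (x $ j) *\<^sub>R x)) = 0"
      using x(1) by (simp add: matrix_vector_mult_scaleR matrix_vector_mul_assoc)
    ultimately show "S \<in> (\<Union>j. N j)"
      by (auto simp: N_def)
  next
    fix S :: "real ^ 'n ^ 'k"
    assume "S \<in> (\<Union>j. N j)"
    then obtain j c where "c \<in> C j" "S *v (X *v c) = 0"
      by (auto simp: N_def)
    then have "c \<noteq> 0" "(S ** X) *v c = 0"
      by (auto simp: C_def matrix_vector_mul_assoc)
    then show "S \<in> {S. \<not> inj ((*v) (S ** X))}"
      by (auto dest: injD[where y=0])
  qed
  note not_inj = this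
  show "{S :: real ^ 'n ^ 'k. \<not> inj ((*v) (S ** X))} \<in> sets borel"
    unfolding not_inj by measurable
  have "AE S in gauss \<sigma>. S \<notin> N j" for j
  proof -
    have "invertible (transpose X ** X)"
      by (rule invertible_gram[OF assms(2)])
    \<comment> \<open>\<open>X *v c\<close> is dual to column \<open>j\<close>: its inner product
      with \<open>X *v x\<close> is the entry \<open>x $ j\<close>.\<close>
    then obtain c where c: "(transpose X ** X) *v c = axis j 1"
      unfolding invertible_def by (metis matrix_vector_mul_assoc matrix_vector_mul_lid)
    have Xc: "(X *v c) \<bullet> (X *v x) = x $ j" for x
    proof -
      have "(X *v c) \<bullet> (X *v x) = (transpose X *v (X *v c)) \<bullet> x"
        by (simp add: dot_lmul_matrix)
      also have "\<dots> = x $ j"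
        using c by (simp only: matrix_vector_mul_assoc) (simp add: inner_axis')
      finally show ?thesis .
    qed
    then have "X *v c \<noteq> 0"
      by (metis axis_nth inner_zero_left zero_neq_one)
    define q where "q = norm (X *v c)"
    define a where "a = (1 / q) *\<^sub>R (X *v c)"
    have q: "q > 0"
      using \<open>X *v c \<noteq> 0\<close> by (simp add: q_def)
    have a: "norm a = 1" "a \<bullet> (X *v x) = x $ j / q" for x
      using q by (simp_all add: a_def Xc) (simp add: q_def)
    have P: "linear (row_proj a)" "\<And>x. row_proj a (row_proj a x) = row_proj a x"
        "\<And>x y. row_proj a x \<bullet> y = x \<bullet> row_proj a y"
      by (simp_all add: linear_row_proj row_proj_idem row_proj_self_adjoint a(1))
    have "AE u in gauss \<sigma>. v - row_proj a v + row_proj a u \<notin> N j" for v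
    proof -
      \<comment> \<open>\<open>H\<close> is the part of the sketched design that \<open>u\<close>
        leaves alone. A kernel vector with entry 1 at \<open>j\<close> would force
        \<open>u *v a\<close> into its range, whose dimension is at most
        \<open>CARD('p)\<close>.\<close>
      define H where "H = (v - row_proj a v) ** X"
      have H: "(v - row_proj a v) *v (X *v x) = H *v x" for x
        by (simp only: H_def matrix_vector_mul_assoc)
      have "dim (range ((*v) H)) \<le> dim (UNIV :: (real ^ 'p) set)"
        by (rule dim_image_le[OF matrix_vector_mul_linear])
      then have "dim (range ((*v) H)) < CARD('k)"
        using assms(3) by simp
      then have "AE u in (gauss \<sigma> :: (real ^ 'n ^ 'k) measure). u *v a \<notin> range ((*v) H)"
        by (rule AE_gauss_mult_notin_subspace[OF assms(1) a(1)])
      then show ?thesis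
      proof (rule eventually_mono)
        fix u :: "real ^ 'n ^ 'k"
        assume u: "u *v a \<notin> range ((*v) H)"
        show "v - row_proj a v + row_proj a u \<notin> N j"
        proof
          assume "v - row_proj a v + row_proj a u \<in> N j"
          then obtain d where d: "d $ j = 1" "H *v d + (1 / q) *\<^sub>R (u *v a) = 0"
            by (auto simp: N_def C_def resample_mult_vector a(2) H)
          have "u *v a = - (q *\<^sub>R (H *v d))"
            using q by (simp add: eq_neg_iff_add_eq_0[THEN iffD2, OF d(2)])
          also have "\<dots> = H *v (- (q *\<^sub>R d))"
            by (simp add: matrix_vector_mult_scaleR vec.neg)
          finally have "u *v a = H *v (- (q *\<^sub>R d))" .
          then show False
            using u by blast
        qed
      qed
    qed
    then show ?thesis
      by (subst AE_gauss_resample_iff[OF assms(1) P]) simp_all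
  qed
  then have "AE S in gauss \<sigma>. \<forall>j. S \<notin> N j"
    by (simp add: AE_all_countable)
  then show "AE S in (gauss \<sigma> :: (real ^ 'n ^ 'k) measure). inj ((*v) (S ** X))"
    by (rule eventually_mono) (use not_inj in blast)
qed

section \<open>The law of the studentized form\<close>

text \<open>By independence the joint law of the entries is a product of normals, which is also the
  law of the coordinates of \<open>gauss\<close> along the matrix units. Rebuilding matrices from
  entries by \<open>rec\<close> transfers the equality.\<close>

lemma gaussian_sketch_distr:
  fixes S :: "'w \<Rightarrow> real ^ 'n ^ 'k"
  assumes "prob_space M" "gaussian_sketch M S"
  shows "S \<in> borel_measurable M" "distr M borel S = gauss (1 / sqrt (real CARD('k)))"
proof -
  define \<sigma> where "\<sigma> = 1 / sqrt (real CARD('k))"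
  have \<sigma>: "\<sigma> > 0"
    by (simp add: \<sigma>_def)
  interpret prob_space M by fact
  define e :: "'k \<times> 'n \<Rightarrow> real ^ 'n ^ 'k" where "e = (\<lambda>(i, j). axis i (axis j 1))"
  let ?N = "\<lambda>_ :: 'k \<times> 'n. centered_normal \<sigma>"
  let ?B = "\<lambda>_ :: 'k \<times> 'n. borel :: real measure"
  define rec :: "('k \<times> 'n \<Rightarrow> real) \<Rightarrow> real ^ 'n ^ 'k" where "rec f = (\<Sum>ij\<in>UNIV. f ij *\<^sub>R e ij)" for f
  have rec_meas [measurable]: "rec \<in> borel_measurable (PiM UNIV ?B)"
    unfolding rec_def by measurable
  have e_inner: "U \<bullet> e (i, j) = U $ i $ j" for U i j
    by (simp add: e_def inner_axis)
  have rec_inner: "rec (\<lambda>ij. U \<bullet> e ij) = U" for U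
  proof -
    have "rec (\<lambda>ij. U \<bullet> e ij) \<bullet> e (i, j) = U \<bullet> e (i, j)" for i j
    proof -
      have e: "e ij \<bullet> e (i, j) = (if ij = (i, j) then 1 else 0)" for ij
        by (cases ij) (auto simp: e_def inner_axis_axis)
      show ?thesis
        by (simp add: rec_def inner_sum_left e if_distrib cong: if_cong)
    qed
    then show ?thesis
      by (simp add: e_inner vec_eq_iff)
  qed
  have S_entry: "distributed M lborel (\<lambda>\<omega>. S \<omega> $ i $ j) (normal_density 0 \<sigma>)" for i j
    using assms(2) by (simp add: gaussian_sketch_def \<sigma>_def)
  have S_meas: "(\<lambda>\<omega>. S \<omega> \<bullet> e ij) \<in> borel_measurable M" for ij
    using distributed_measurable[OF S_entry] by (cases ij) (simp add: e_inner)
  have "indep_vars ?B (\<lambda>(i, j) \<omega>. S \<omega> $ i $ j) UNIV"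
    using assms(2) by (simp add: gaussian_sketch_def)
  also have "(\<lambda>(i, j) \<omega>. S \<omega> $ i $ j) = (\<lambda>ij \<omega>. S \<omega> \<bullet> e ij)"
    by (auto simp: fun_eq_iff e_inner)
  finally have "distr M (PiM UNIV ?B) (\<lambda>\<omega>. \<lambda>ij\<in>UNIV. S \<omega> \<bullet> e ij) = PiM UNIV (\<lambda>ij. distr M borel (\<lambda>\<omega>. S \<omega> \<bullet> e ij))"
    using S_meas by (subst (asm) indep_vars_iff_distr_eq_PiM) auto
  also have "(\<lambda>ij. distr M borel (\<lambda>\<omega>. S \<omega> \<bullet> e ij)) = ?N"
  proof
    fix ij :: "'k \<times> 'n"
    obtain i j where ij: "ij = (i, j)" by (cases ij)
    show "distr M borel (\<lambda>\<omega>. S \<omega> \<bullet> e ij) = centered_normal \<sigma>"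
      using distributed_distr_eq_density[OF S_entry[of i j]]
      by (simp add: ij e_inner centered_normal_def cong: distr_cong)
  qed
  also have "PiM UNIV ?N = distr (gauss \<sigma>) (PiM UNIV ?B) (\<lambda>u. \<lambda>ij\<in>UNIV. u \<bullet> e ij)"
    by (rule distr_gauss_orthonormal[symmetric])
       (use \<sigma> in \<open>auto simp: e_def inner_axis_axis split: if_split_asm\<close>)
  finally have eq: "distr M (PiM UNIV ?B) (\<lambda>\<omega> ij. S \<omega> \<bullet> e ij) = distr (gauss \<sigma>) (PiM UNIV ?B) (\<lambda>u ij. u \<bullet> e ij)"
    by (simp only: restrict_UNIV)
  have S_coords [measurable]: "(\<lambda>\<omega> ij. S \<omega> \<bullet> e ij) \<in> M \<rightarrow>\<^sub>M PiM UNIV ?B"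
  proof -
    have "(\<lambda>\<omega>. \<lambda>ij\<in>UNIV. S \<omega> \<bullet> e ij) \<in> M \<rightarrow>\<^sub>M PiM UNIV ?B"
      by (rule measurable_restrict) (rule S_meas)
    then show ?thesis
      by (simp only: restrict_UNIV)
  qed
  have u_coords [measurable]: "(\<lambda>u ij. u \<bullet> e ij) \<in> gauss \<sigma> \<rightarrow>\<^sub>M PiM UNIV ?B"
  proof -
    have "(\<lambda>u. \<lambda>ij\<in>UNIV. u \<bullet> e ij) \<in> gauss \<sigma> \<rightarrow>\<^sub>M PiM UNIV ?B"
      by (rule measurable_restrict) simp
    then show ?thesis
      by (simp only: restrict_UNIV)
  qed
  have "(\<lambda>\<omega>. rec (\<lambda>ij. S \<omega> \<bullet> e ij)) \<in> borel_measurable M"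
    by measurable
  then show "S \<in> borel_measurable M"
    by (simp add: rec_inner)
  have "distr M borel S = distr (distr M (PiM UNIV ?B) (\<lambda>\<omega> ij. S \<omega> \<bullet> e ij)) borel rec"
    by (subst distr_distr) (simp_all add: comp_def rec_inner)
  also have "\<dots> = distr (gauss \<sigma>) borel (\<lambda>u. u)"
    unfolding eq by (subst distr_distr) (simp_all add: comp_def rec_inner)
  also have "\<dots> = gauss \<sigma>"
    by (simp add: distr_id2)
  finally show "distr M borel S = gauss (1 / sqrt (real CARD('k)))"
    by (simp add: \<sigma>_def)
qed

text \<open>The statistic as a function of the inverse Gram matrix alone, with \<open>b\<close> for
  \<open>transpose X *v y\<close>. The factors \<open>\<gamma>\<close> are kept so that the
  estimators unfold to exactly this term.\<close>

definition studentized_form :: "real \<Rightarrow> real \<Rightarrow> real ^ 'p ^ 'p \<Rightarrow> real ^ 'p \<Rightarrow> real ^ 'p \<Rightarrow> real" where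
  "studentized_form \<nu> \<gamma> A b m =
    \<gamma> * (m \<bullet> (A *v b)) * sqrt (\<nu> / (\<gamma> * (b \<bullet> (A *v b)) * \<gamma> * (m \<bullet> (A *v m)) - (\<gamma> * (m \<bullet> (A *v b)))\<^sup>2))"

lemma borel_measurable_studentized_form:
  "(\<lambda>S. studentized_form \<nu> \<gamma> (sketched_gram_inv S X) b m) \<in> borel_measurable borel"
proof -
  have "(\<lambda>S. (transpose (S ** X) ** (S ** X)) $ i $ j) \<in> borel_measurable borel" for i j
    unfolding transpose_def matrix_matrix_mult_def vec_lambda_beta
    by (intro borel_measurable_continuous_onI continuous_intros)
  then have entry: "(\<lambda>S. (sketched_gram_inv S X *v x) $ i) \<in> borel_measurable borel" for x i
    unfolding sketched_gram_inv_def by (rule borel_measurable_matrix_inv_mult)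
  have [measurable]: "(\<lambda>S. w \<bullet> (sketched_gram_inv S X *v x)) \<in> borel_measurable borel" for w x
    unfolding inner_vec_def inner_real_def
    by (intro borel_measurable_sum borel_measurable_times borel_measurable_const entry)
  show ?thesis
    unfolding studentized_form_def by measurable
qed

text \<open>Here \<open>v\<close> is fixed and supplies all of the sketch except its action on
  \<open>a\<close>. The randomness enters only through \<open>u *v a\<close>, and the resulting law
  does not depend on \<open>v\<close>.\<close>

lemma conditional_studentized_form_student:
  fixes X :: "real ^ 'p ^ 'n" and v :: "real ^ 'n ^ 'k" and a :: "real ^ 'n"
  assumes "\<sigma> > 0" and card: "CARD('p) < CARD('k)"
    and \<nu>: "\<nu> = real CARD('k) - real CARD('p) + 1" and "\<gamma> > 0"
    and "b \<noteq> 0" "m \<bullet> c = q\<^sup>2" "b \<bullet> c = 0" "q > 0"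
    and a: "norm a = 1" "X *v c = q *\<^sub>R a" "\<And>x. a \<bullet> (X *v x) = m \<bullet> x / q"
    and inj: "AE u in (gauss \<sigma> :: (real ^ 'n ^ 'k) measure). inj ((*v) ((v - row_proj a v + row_proj a u) ** X))"
  shows "distr (gauss \<sigma>) borel
      (\<lambda>u. studentized_form \<nu> \<gamma> (sketched_gram_inv (v - row_proj a v + row_proj a u) X) b m) =
    density lborel (\<lambda>t. ennreal (student_t_density \<nu> t))"
proof -
  interpret prob_space "gauss \<sigma> :: (real ^ 'n ^ 'k) measure"
    by (rule prob_space_gauss[OF assms(1)])
  define S where "S u = v - row_proj a v + row_proj a u" for u
  define H where "H = (v - row_proj a v) ** X"
  define K where "K = {x. m \<bullet> x = 0}"
  have m0: "m \<noteq> 0"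
    using assms(6,8) by auto
  have G: "(S u ** X) *v x = H *v x + (m \<bullet> x / q) *\<^sub>R (u *v a)" for u x
    by (simp only: S_def H_def matrix_vector_mul_assoc[symmetric] resample_mult_vector a(3))
  have GK: "(S u ** X) *v x = H *v x" if "x \<in> K" for u x
    using that by (simp add: G K_def)
  have K: "subspace K"
    by (simp add: K_def subspace_hyperplane)
  have injK: "inj_on ((*v) H) K"
  proof -
    \<comment> \<open>On \<open>K\<close> the sketched design does not involve \<open>u\<close>, so
      one good \<open>u\<close> suffices; it exists because an almost sure event of a probability
      space is nonempty.\<close>
    obtain u where "inj ((*v) (S u ** X))"
      using inj AE_const[of False] by (metis (mono_tags, lifting) S_def eventually_mono)
    then show ?thesis
      by (intro inj_onI) (metis GK injD)
  qed
  define V where "V = (*v) H ` K"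
  have V: "subspace V"
    unfolding V_def by (intro linear_subspace_image matrix_vector_mul_linear K)
  have "dim V = dim K"
    unfolding V_def using injK K
    by (intro dim_image_eq matrix_vector_mul_linear) (simp add: span_eq_iff[THEN iffD2])
  then have dimV: "dim V = CARD('p) - 1"
    using dim_hyperplane[OF m0] by (simp add: K_def)
  obtain B where B: "finite B" "card B = DIM(real ^ 'k) - dim V"
      "\<And>d e. d \<in> B \<Longrightarrow> e \<in> B \<Longrightarrow> d \<bullet> e = (if d = e then 1 else 0)"
      "\<And>x e. x \<in> V \<Longrightarrow> e \<in> B \<Longrightarrow> x \<bullet> e = 0"
      "\<And>z. z - (\<Sum>e\<in>B. (z \<bullet> e) *\<^sub>R e) \<in> V"
    by (rule subspace_complement_frame[OF V]) (rule that)
  \<comment> \<open>The complement of \<open>V\<close> has dimension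
    \<open>CARD('k) - (CARD('p) - 1)\<close>, the degrees of freedom; positivity makes the truncated
    subtraction exact.\<close>
  have "CARD('p) > 0"
    by simp
  then have cardB: "\<nu> = real (card B)" "B \<noteq> {}"
    using card dimV B(2) \<nu> by (simp_all add: of_nat_diff) (auto simp: card_eq_0_iff)
  obtain s where s': "s \<in> (*v) H ` K" and s_inner: "\<And>x. x \<in> K \<Longrightarrow> (H *v x) \<bullet> s = x \<bullet> b"
    by (rule inner_on_subspace_representer[where b=b, OF matrix_vector_mul_linear K injK]) (rule that)
  have s: "s \<in> V" "\<And>x. x \<in> K \<Longrightarrow> (H *v x) \<bullet> s = x \<bullet> b"
    using s' s_inner by (simp_all add: V_def)
  obtain xs where xs: "xs \<in> K" "s = H *v xs"
    using s(1) by (auto simp: V_def)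
  \<comment> \<open>The projection of \<open>b\<close> to \<open>K\<close> along \<open>c\<close>
    has inner product \<open>b \<bullet> b\<close> with \<open>b\<close>, since \<open>b\<close> and
    \<open>c\<close> are orthogonal; \<open>s = 0\<close> would make it vanish.\<close>
  have s0: "s \<noteq> 0"
  proof
    assume "s = 0"
    moreover have "b - (m \<bullet> b / q\<^sup>2) *\<^sub>R c \<in> K"
      using assms(6,8) by (simp add: K_def inner_diff_right)
    ultimately have "(b - (m \<bullet> b / q\<^sup>2) *\<^sub>R c) \<bullet> b = 0"
      using s(2) by fastforce
    then have "b \<bullet> b = 0"
      using assms(7) by (simp only: inner_diff_left inner_scaleR_left inner_commute[of c b] mult_zero_right diff_zero)
    then show False
      using assms(5) by simp
  qed
  \<comment> \<open>The sign absorbs the minus in the closed form of the ratio.\<close>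
  define w where "w = - (1 / norm s) *\<^sub>R s"
  have "norm w = 1"
    using s0 by (simp add: w_def)
  then have ww: "w \<bullet> w = 1"
    by (simp only: norm_eq_1)
  have w: "w \<bullet> e = 0" "e \<bullet> w = 0" if "e \<in> B" for e
  proof -
    show "w \<bullet> e = 0"
      using B(4)[OF s(1) that] by (simp add: w_def)
    then show "e \<bullet> w = 0"
      by (simp only: inner_commute)
  qed
  have wB: "w \<notin> B"
    using w(1)[of w] ww by auto
  \<comment> \<open>The coordinate of \<open>u\<close> along \<open>?e d\<close> is that of
    \<open>u *v a\<close> along \<open>d\<close>, so orthonormality of \<open>w\<close> and
    \<open>B\<close> carries over to matrix space.\<close>
  let ?e = "\<lambda>d. outer d a :: real ^ 'n ^ 'k"
  let ?X = "\<lambda>u. \<lambda>d\<in>insert w B. u \<bullet> ?e d"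
  let ?F = "\<lambda>x. x w * sqrt (\<nu> / (\<Sum>d\<in>B. (x d)\<^sup>2))"
  let ?T = "\<lambda>u. studentized_form \<nu> \<gamma> (sketched_gram_inv (S u) X) b m"
  have form: "?T u = ?F (?X u)" if "inj ((*v) (S u ** X))" for u
  proof -
    define z where "z = u *v a"
    define r where "r = (\<Sum>e\<in>B. (z \<bullet> e) *\<^sub>R e)"
    obtain xz where xz: "xz \<in> K" "z - r = H *v xz"
      using B(5)[of z] by (auto simp: V_def r_def)
    \<comment> \<open>\<open>X *v c\<close> is a multiple of \<open>a\<close>, which the unresampled
      part of the sketch annihilates.\<close>
    have "H *v c = 0"
      using row_proj_complement_mult_vector[OF a(1), of v]
      by (simp add: H_def matrix_vector_mul_assoc[symmetric] a(2) matrix_vector_mult_scaleR)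
    then have Gc: "(S u ** X) *v c = q *\<^sub>R z"
      using assms(6,8) by (simp add: G z_def power2_eq_square)
    have rV: "x \<bullet> r = 0" if "x \<in> V" for x
      using B(4)[OF that] by (simp add: r_def inner_sum_right)
    have prems: "z = (S u ** X) *v xz + r" "m \<bullet> xz = 0" "\<And>x. m \<bullet> x = 0 \<Longrightarrow> ((S u ** X) *v x) \<bullet> r = 0"
      "s = (S u ** X) *v xs" "m \<bullet> xs = 0" "\<And>x. m \<bullet> x = 0 \<Longrightarrow> ((S u ** X) *v x) \<bullet> s = x \<bullet> b"
    proof -
      show "z = (S u ** X) *v xz + r"
        by (simp add: GK[OF xz(1)] xz(2)[symmetric])
      show "m \<bullet> xz = 0" "m \<bullet> xs = 0"
        using xz(1) xs(1) by (simp_all add: K_def)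
      show "s = (S u ** X) *v xs"
        using GK[OF xs(1)] xs(2) by simp
      fix x assume "m \<bullet> x = 0"
      then have x: "x \<in> K"
        by (simp add: K_def)
      show "((S u ** X) *v x) \<bullet> r = 0"
        unfolding GK[OF x] by (rule rV) (use x in \<open>simp add: V_def\<close>)
      show "((S u ** X) *v x) \<bullet> s = x \<bullet> b"
        unfolding GK[OF x] by (rule s(2)[OF x])
    qed
    let ?A = "matrix_inv (transpose (S u ** X) ** (S u ** X))"
    have forms: "r \<noteq> 0" "m \<bullet> (?A *v b) = - (q * (z \<bullet> s) / (r \<bullet> r))"
      "b \<bullet> (?A *v b) = s \<bullet> s + (z \<bullet> s)\<^sup>2 / (r \<bullet> r)" "m \<bullet> (?A *v m) = q\<^sup>2 / (r \<bullet> r)"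
      by (rule inverse_gram_quadratic_forms[OF that assms(8,6,7) Gc prems]; assumption)+
    have rr: "r \<bullet> r = (\<Sum>e\<in>B. (z \<bullet> e)\<^sup>2)"
    proof -
      have re: "r \<bullet> e = z \<bullet> e" if "e \<in> B" for e
      proof -
        have "r \<bullet> e = (\<Sum>d\<in>B. (z \<bullet> d) * (d \<bullet> e))"
          by (simp add: r_def inner_sum_left)
        also have "\<dots> = (\<Sum>d\<in>B. if d = e then z \<bullet> e else 0)"
          using B(3)[OF _ that] by (intro sum.cong) auto
        also have "\<dots> = z \<bullet> e"
          using B(1) that by simp
        finally show ?thesis .
      qed
      have "r \<bullet> r = (\<Sum>e\<in>B. (z \<bullet> e) * (r \<bullet> e))"
        by (subst (2) r_def) (simp add: inner_sum_right)
      also have "\<dots> = (\<Sum>e\<in>B. (z \<bullet> e)\<^sup>2)"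
        by (intro sum.cong) (simp_all add: re power2_eq_square)
      finally show ?thesis .
    qed
    have "?T u = - (z \<bullet> s / norm s) * sqrt (\<nu> / (r \<bullet> r))"
      unfolding studentized_form_def sketched_gram_inv_def forms(2-4)
        power2_norm_eq_inner[symmetric, of s]
      by (rule studentized_ratio_eq)
         (use assms(4,8) s0 forms(1) cardB B(1) in \<open>simp_all add: card_gt_0_iff\<close>)
    also have "- (z \<bullet> s / norm s) = u \<bullet> ?e w"
      by (simp add: inner_outer z_def[symmetric] w_def inner_commute[of z s])
    also have "r \<bullet> r = (\<Sum>d\<in>B. (?X u d)\<^sup>2)"
      unfolding rr by (intro sum.cong) (simp_all add: inner_outer z_def inner_commute[of "u *v a"])
    finally show ?thesis
      by simp
  qed
  have [measurable]: "(row_proj a :: real ^ 'n ^ 'k \<Rightarrow> _) \<in> borel_measurable borel"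
    by (rule borel_measurable_linear[OF linear_row_proj])
  have S_meas: "S \<in> borel_measurable (gauss \<sigma>)"
    unfolding S_def by measurable
  have T_meas: "?T \<in> borel_measurable (gauss \<sigma>)"
    by (rule measurable_compose[OF S_meas borel_measurable_studentized_form])
  have F_meas: "?F \<in> borel_measurable (PiM (insert w B) (\<lambda>_. borel))"
    by measurable
  have X_meas: "?X \<in> gauss \<sigma> \<rightarrow>\<^sub>M PiM (insert w B) (\<lambda>_. borel)"
    by measurable
  \<comment> \<open>The closed form holds where the sketched design is injective, hence almost
    surely, which is enough for the law.\<close>
  have "distr (gauss \<sigma>) borel ?T = distr (gauss \<sigma>) borel (\<lambda>u. ?F (?X u))"
  proof (rule distr_cong_AE)
    show "AE u in gauss \<sigma>. ?T u = ?F (?X u)"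
      using inj by (rule eventually_mono) (rule form, simp add: S_def)
  qed (use T_meas measurable_compose[OF X_meas F_meas] in simp_all)
  also have "\<dots> = distr (distr (gauss \<sigma>) (PiM (insert w B) (\<lambda>_. borel)) ?X) borel ?F"
    using distr_distr[OF F_meas X_meas] by (simp add: comp_def)
  also have "distr (gauss \<sigma>) (PiM (insert w B) (\<lambda>_. borel)) ?X = PiM (insert w B) (\<lambda>_. centered_normal \<sigma>)"
  proof (rule distr_gauss_orthonormal[OF assms(1)])
    show "finite (insert w B)"
      using B(1) by simp
    fix i j assume ij: "i \<in> insert w B" "j \<in> insert w B"
    have "a \<bullet> a = 1"
      using a(1) by (simp only: norm_eq_1)
    then have "?e i \<bullet> ?e j = i \<bullet> j"
      by (simp add: inner_outer outer_mult_vector inner_commute[of j i])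
    then show "?e i \<bullet> ?e j = (if i = j then 1 else 0)"
      using ij wB w ww B(3)[of i j] by (cases "i = w"; cases "j = w") auto
  qed
  also have "distr \<dots> borel ?F = density lborel (\<lambda>t. ennreal (student_t_density \<nu> t))"
    by (rule distr_normal_ratio_student[OF assms(1) cardB(1) B(1) cardB(2) wB])
  finally show ?thesis
    by (simp add: S_def)
qed

text \<open>Averaging over \<open>v\<close>: with \<open>a\<close> along \<open>X *v c\<close>,
  almost every \<open>v\<close> gives the same conditional law, so the mixture is that law.\<close>

lemma gauss_studentized_form_student:
  fixes X :: "real ^ 'p ^ 'n" and b m c :: "real ^ 'p"
  assumes "\<sigma> > 0" "inj ((*v) X)" "CARD('p) < CARD('k)"
    and \<nu>: "\<nu> = real CARD('k) - real CARD('p) + 1" and "\<gamma> > 0"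
    and "b \<noteq> 0" "m \<noteq> 0" and c: "(transpose X ** X) *v c = m" "b \<bullet> c = 0"
  shows "distr (gauss \<sigma> :: (real ^ 'n ^ 'k) measure) borel
      (\<lambda>S. studentized_form \<nu> \<gamma> (sketched_gram_inv S X) b m) =
    density lborel (\<lambda>t. ennreal (student_t_density \<nu> t))" (is "distr ?g borel ?T = ?D")
proof (rule measure_eqI)
  interpret prob_space ?g
    by (rule prob_space_gauss[OF assms(1)])
  have Xc: "(X *v c) \<bullet> (X *v x) = m \<bullet> x" for x
  proof -
    have "(X *v c) \<bullet> (X *v x) = (transpose X *v (X *v c)) \<bullet> x"
      by (simp add: dot_lmul_matrix)
    then show ?thesis
      by (simp only: matrix_vector_mul_assoc c(1))
  qed
  define q where "q = norm (X *v c)"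
  define a where "a = (1 / q) *\<^sub>R (X *v c)"
  have "X *v c \<noteq> 0"
    using Xc[of m] assms(7) by auto
  then have q: "q > 0"
    by (simp add: q_def)
  have a: "norm a = 1" "X *v c = q *\<^sub>R a" "a \<bullet> (X *v x) = m \<bullet> x / q" for x
    using q by (simp_all add: a_def Xc) (simp add: q_def)
  have mc: "m \<bullet> c = q\<^sup>2"
    by (simp add: q_def power2_norm_eq_inner Xc)
  have P: "linear (row_proj a)" "\<And>x. row_proj a (row_proj a x) = row_proj a x"
      "\<And>x y. row_proj a x \<bullet> y = x \<bullet> row_proj a y"
    by (simp_all add: linear_row_proj row_proj_idem row_proj_self_adjoint a(1))
  note [measurable] = borel_measurable_studentized_form[of \<nu> \<gamma> X b m]
  have P_meas [measurable]: "(row_proj a :: real ^ 'n ^ 'k \<Rightarrow> _) \<in> borel_measurable borel"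
    by (rule borel_measurable_linear[OF linear_row_proj])
  fix E assume "E \<in> sets (distr ?g borel ?T)"
  then have E [measurable]: "E \<in> sets borel" by simp
  have "AE S in ?g. S \<notin> {S. \<not> inj ((*v) (S ** X))}"
    using AE_gauss_inj_mult(1)[OF assms(1-3)] by simp
  then have inj: "AE v in ?g. AE u in ?g. inj ((*v) ((v - row_proj a v + row_proj a u) ** X))"
    by (subst (asm) AE_gauss_resample_iff[OF assms(1) P AE_gauss_inj_mult(2)[OF assms(1-3)]]) simp
  have "emeasure (distr ?g borel ?T) E = (\<integral>\<^sup>+S. indicator E (?T S) \<partial>?g)"
    by (subst nn_integral_indicator[symmetric], simp, subst nn_integral_distr) simp_all
  also have "\<dots> = (\<integral>\<^sup>+v. \<integral>\<^sup>+u. indicator E (?T (v - row_proj a v + row_proj a u)) \<partial>?g \<partial>?g)"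
    by (rule nn_integral_gauss_resample[OF assms(1) P]) measurable
  also have "\<dots> = (\<integral>\<^sup>+v. emeasure ?D E \<partial>?g)"
  proof (rule nn_integral_cong_AE, rule eventually_mono[OF inj])
    fix v :: "real ^ 'n ^ 'k"
    assume v: "AE u in ?g. inj ((*v) ((v - row_proj a v + row_proj a u) ** X))"
    let ?Tv = "\<lambda>u. ?T (v - row_proj a v + row_proj a u)"
    have "(\<integral>\<^sup>+u. indicator E (?Tv u) \<partial>?g) = emeasure (distr ?g borel ?Tv) E"
      by (subst nn_integral_indicator[symmetric], simp, subst nn_integral_distr) simp_all
    also have "distr ?g borel ?Tv = ?D"
      by (rule conditional_studentized_form_student[OF assms(1,3) \<nu> assms(5,6) mc c(2) q a v])
    finally show "(\<integral>\<^sup>+u. indicator E (?Tv u) \<partial>?g) = emeasure ?D E" .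
  qed
  also have "\<dots> = emeasure ?D E"
    using emeasure_space_1 by simp
  finally show "emeasure (distr ?g borel ?T) E = emeasure ?D E" .
qed simp

theorem mainTheorem6:
  fixes X :: "real ^ 'p ^ 'n" and y :: "real ^ 'n"
    and M :: "'w measure" and S :: "'w \<Rightarrow> real ^ 'n ^ 'k"
    and \<nu> \<gamma> :: real
  assumes "2 \<le> CARD('p)" and "CARD('p) < CARD('n)" and "CARD('k) > CARD('p) + 1"
    and "rank X = CARD('p)"
    and "transpose X *v y \<noteq> 0"
    and "prob_space M" and "gaussian_sketch M S"
  defines "\<nu> \<equiv> real CARD('k) - real CARD('p) + 1"
    and "\<gamma> \<equiv> debias_factor CARD('k) CARD('p)"
  shows "(\<forall>m :: real ^ 'p.
            m \<noteq> 0 \<and> m \<bullet> (transpose X *v y) \<noteq> norm m * norm (transpose X *v y) \<and>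
            m \<bullet> beta_full X y = 0 \<longrightarrow>
            distributed M lborel
              (\<lambda>\<omega>. m \<bullet> beta_partial (S \<omega>) X y *
                 sqrt (\<nu> / (SSM_partial (S \<omega>) X y * \<gamma> * (m \<bullet> (sketched_gram_inv (S \<omega>) X *v m))
                              - (m \<bullet> beta_partial (S \<omega>) X y)\<^sup>2)))
              (\<lambda>x. ennreal (student_t_density \<nu> x))) \<and>
         (\<forall>j :: 'p.
            beta_full X y $ j = 0 \<longrightarrow>
            distributed M lborel
              (\<lambda>\<omega>. beta_partial (S \<omega>) X y $ j *
                 sqrt (\<nu> / (SSM_partial (S \<omega>) X y * \<gamma> * (sketched_gram_inv (S \<omega>) X $ j $ j)
                              - (beta_partial (S \<omega>) X y $ j)\<^sup>2)))
              (\<lambda>x. ennreal (student_t_density \<nu> x)))"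
proof -
  let ?b = "transpose X *v y"
  let ?A = "\<lambda>\<omega>. sketched_gram_inv (S \<omega>) X"
  have inj: "inj ((*v) X)"
    using assms(4) full_rank_injective by blast
  have \<gamma>: "\<gamma> > 0"
    using assms(3) by (simp add: \<gamma>_def debias_factor_def)
  have sketch: "S \<in> borel_measurable M" "distr M borel S = gauss (1 / sqrt (real CARD('k)))"
    using gaussian_sketch_distr[OF assms(6,7)] by simp_all
  have beta: "m \<bullet> beta_partial (S \<omega>) X y = \<gamma> * (m \<bullet> (?A \<omega> *v ?b))" for m \<omega>
    by (simp add: beta_partial_def \<gamma>_def)
  have SSM: "SSM_partial (S \<omega>) X y = \<gamma> * (?b \<bullet> (?A \<omega> *v ?b))" for \<omega>
  proof -
    have "SSM_partial (S \<omega>) X y = ?b \<bullet> beta_partial (S \<omega>) X y"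
      by (simp add: SSM_partial_def dot_lmul_matrix)
    then show ?thesis
      by (simp only: beta)
  qed
  have main: "distributed M lborel
      (\<lambda>\<omega>. m \<bullet> beta_partial (S \<omega>) X y *
         sqrt (\<nu> / (SSM_partial (S \<omega>) X y * \<gamma> * (m \<bullet> (?A \<omega> *v m)) - (m \<bullet> beta_partial (S \<omega>) X y)\<^sup>2)))
      (\<lambda>x. ennreal (student_t_density \<nu> x))"
    if m: "m \<noteq> 0" "m \<bullet> beta_full X y = 0" for m
  proof -
    let ?T = "\<lambda>S. studentized_form \<nu> \<gamma> (sketched_gram_inv S X) ?b m"
    have "invertible (transpose X ** X)"
      by (rule invertible_gram[OF inj])
    then obtain R where R: "(transpose X ** X) ** R = mat 1"
      unfolding invertible_def by blast
    define c where "c = R *v m"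
    have c: "(transpose X ** X) *v c = m"
      by (simp add: c_def matrix_vector_mul_assoc R)
    \<comment> \<open>By symmetry of the Gram matrix this inner product equals
      \<open>m \<bullet> beta_full X y\<close>.\<close>
    have "?b \<bullet> c = 0"
    proof -
      let ?f = "beta_full X y"
      have f: "(transpose X ** X) *v ?f = ?b"
      proof -
        have "(transpose X ** X) ** matrix_inv (transpose X ** X) = mat 1"
          by (rule matrix_left_right_inverse[THEN iffD1, OF matrix_inv_left_inverse[OF invertible_gram[OF inj]]])
        then show ?thesis
          by (simp only: beta_full_def matrix_vector_mul_assoc[of _ "matrix_inv _"] matrix_vector_mul_lid)
      qed
      have "?b \<bullet> c = (X *v ?f) \<bullet> (X *v c)"
        unfolding f[symmetric] matrix_vector_mul_assoc[symmetric] by (simp add: dot_lmul_matrix)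
      also have "\<dots> = ?f \<bullet> ((transpose X ** X) *v c)"
        unfolding matrix_vector_mul_assoc[symmetric]
        by (simp add: dot_lmul_matrix inner_commute[of ?f] inner_commute[of "X *v ?f"])
      also have "\<dots> = 0"
        using m(2) by (simp add: c inner_commute)
      finally show ?thesis .
    qed
    then have "distr (gauss (1 / sqrt (real CARD('k))) :: (real ^ 'n ^ 'k) measure) borel ?T =
        density lborel (\<lambda>t. ennreal (student_t_density \<nu> t))"
      using assms(3,5) inj \<gamma> m(1) c
      by (intro gauss_studentized_form_student) (simp_all add: \<nu>_def)
    then have "distr M borel (\<lambda>\<omega>. ?T (S \<omega>)) = density lborel (\<lambda>t. ennreal (student_t_density \<nu> t))"
      unfolding sketch(2)[symmetric]
      using distr_distr[OF borel_measurable_studentized_form sketch(1), of \<nu> \<gamma> X ?b m]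
      by (simp add: comp_def)
    moreover have "(\<lambda>\<omega>. ?T (S \<omega>)) \<in> borel_measurable M"
      using measurable_compose[OF sketch(1) borel_measurable_studentized_form] .
    moreover have "(\<lambda>t. ennreal (student_t_density \<nu> t)) \<in> borel_measurable lborel"
      unfolding student_t_density_def by measurable
    ultimately have "distributed M lborel (\<lambda>\<omega>. ?T (S \<omega>)) (\<lambda>t. ennreal (student_t_density \<nu> t))"
      unfolding distributed_def by (simp cong: distr_cong)
    then show ?thesis
      unfolding studentized_form_def beta SSM .
  qed
  show ?thesis
  proof (intro conjI allI impI)
    \<comment> \<open>The case \<open>m = axis j 1\<close>: inner products read off entry
      \<open>j\<close>, and the quadratic form reads off the diagonal entry.\<close>
    fix j :: 'p
    assume "beta_full X y $ j = 0"
    then show "distributed M lborel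
        (\<lambda>\<omega>. beta_partial (S \<omega>) X y $ j *
           sqrt (\<nu> / (SSM_partial (S \<omega>) X y * \<gamma> * (?A \<omega> $ j $ j) - (beta_partial (S \<omega>) X y $ j)\<^sup>2)))
        (\<lambda>x. ennreal (student_t_density \<nu> x))"
      using main[of "axis j 1"] by (simp add: inner_axis' matrix_vector_mult_basis column_def axis_eq_0_iff)
  qed (use main in blast)
qed

end
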